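(* Let $X=(X_t)_{t\ge0}$ be a continuous positive local $\mathbb{P}$-martingale that converges to zero $\mathbb{P}$-a.s. as $t\to\infty$. For increasing sequences $a=(a_n)_{n\in\mathbb{N}}$ and $b=(b_n)_{n\in\mathbb{N}}$ of positive real numbers converging to infinity, define $\tau^{a,b}_0:=0$, $$\tau^{a,b}_n:=\inf\{t\ge0: X_t\ge b_n\}\wedge a_n,\quad n\in\mathbb{N},$$ and $S^{a,b}_n:=X_{\tau^{a,b}_n}$ for $n\in\mathbb{N}_0$. Then $X$ is a strict local $\mathbb{P}$-martingale if and only if for all increasing sequences $a=(a_n)_{n\in\mathbb{N}}$ and $b=(b_n)_{n\in\mathbb{N}}$ of positive real numbers converging to infinity, the measure $\mathbb{P}$ is a bubble measure for the discrete-time martingale $S^{a,b}=(S^{a,b}_n)_{n\in\mathbb{N}_0}$.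
   Context: A strict local $\mathbb{P}$-martingale is a local $\mathbb{P}$-martingale that is not a $\mathbb{P}$-martingale; here a local martingale is an adapted process $X$ for which there are stopping times $\sigma_n\uparrow\infty$ a.s. such that each stopped process $X^{\sigma_n}$ is a martingale (in particular $X_0$ is integrable). $S^{a,b}$ is a martingale for the filtration $(\mathcal{F}_{\tau^{a,b}_n})_{n\in\mathbb{N}_0}$. Definition (bubble): a nonnegative discrete-time martingale $S=(S_k)_{k\in\mathbb{N}_0}$ converges $\mathbb{P}$-a.s. to some integrable $S_\infty$. Put $\tau_0:=0$ and $\tau_k:=\inf\{j>\tau_{k-1}: S_j<S_{j-1}\}$ for $k\in\mathbb{N}$ ($\inf\emptyset=\infty$), and $S_{\tau_k}:=S_\infty$ on $\{\tau_k=\infty\}$. $S$ is a bubble, and $\mathbb{P}$ is a bubble measure for $S$, if $\mathbb{E}[S_{\tau_k}]<\mathbb{E}[S_0]$ for some $k\in\mathbb{N}$. *)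

theory Defs
  imports "HOL-Probability.Probability"
begin

text \<open>
  Continuous time \<open>[0,\<infinity>)\<close> is the set \<open>{0..} :: real set\<close>. Filtrations and processes are functions
  on all of \<open>real\<close>, but what they do at negative times is irrelevant: a filtration
  on \<open>[0,\<infinity>)\<close> extends to negative times by its value at 0.
\<close>

locale filtered_prob_space = prob_space M + filtration "space M" F
  for M :: "'a measure"
    and F :: "'t::{linorder_topology, second_countable_topology} \<Rightarrow> 'a measure" +
  assumes sets_F_subset: "sets (F t) \<subseteq> sets M"

definition martingale ::
  "'a measure \<Rightarrow> ('t::{linorder_topology, second_countable_topology} \<Rightarrow> 'a measure) \<Rightarrow>
    't set \<Rightarrow> ('t \<Rightarrow> 'a \<Rightarrow> real) \<Rightarrow> bool"
where
  "martingale M F I Y \<longleftrightarrow>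
     filtered_prob_space M F \<and>
     (\<forall>t\<in>I. Y t \<in> borel_measurable (F t)) \<and>
     (\<forall>t\<in>I. integrable M (Y t)) \<and>
     (\<forall>s\<in>I. \<forall>t\<in>I. s \<le> t \<longrightarrow> (AE \<omega> in M. real_cond_exp M (F s) (Y t) \<omega> = Y s \<omega>))"

text \<open>
  The library's \<open>stopping_time\<close> takes values in the index type of the filtration, hence is finite
  for the index type \<open>real\<close>. Localizing sequences need stopping times with values in \<open>[0,\<infinity>]\<close>.
\<close>

definition stopping_time_infty :: "(real \<Rightarrow> 'a measure) \<Rightarrow> ('a \<Rightarrow> ennreal) \<Rightarrow> bool"
where
  "stopping_time_infty F \<sigma> \<longleftrightarrow> (\<forall>t\<ge>0. Measurable.pred (F t) (\<lambda>\<omega>. \<sigma> \<omega> \<le> ennreal t))"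

definition stopped_process ::
  "(real \<Rightarrow> 'a \<Rightarrow> real) \<Rightarrow> ('a \<Rightarrow> ennreal) \<Rightarrow> real \<Rightarrow> 'a \<Rightarrow> real"
where
  "stopped_process X \<sigma> t \<omega> = X (enn2real (min (\<sigma> \<omega>) (ennreal t))) \<omega>"

definition local_martingale ::
  "'a measure \<Rightarrow> (real \<Rightarrow> 'a measure) \<Rightarrow> (real \<Rightarrow> 'a \<Rightarrow> real) \<Rightarrow> bool"
where
  "local_martingale M F X \<longleftrightarrow>
     filtered_prob_space M F \<and>
     (\<forall>t\<ge>0. X t \<in> borel_measurable (F t)) \<and>
     (\<exists>\<sigma> :: nat \<Rightarrow> 'a \<Rightarrow> ennreal.
        (\<forall>n. stopping_time_infty F (\<sigma> n)) \<and>
        (AE \<omega> in M. incseq (\<lambda>n. \<sigma> n \<omega>) \<and> (\<lambda>n. \<sigma> n \<omega>) \<longlonglongrightarrow> \<infinity>) \<and>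
        (\<forall>n. martingale M F {0..} (stopped_process X (\<sigma> n))))"

definition strict_local_martingale ::
  "'a measure \<Rightarrow> (real \<Rightarrow> 'a measure) \<Rightarrow> (real \<Rightarrow> 'a \<Rightarrow> real) \<Rightarrow> bool"
where
  "strict_local_martingale M F X \<longleftrightarrow> local_martingale M F X \<and> \<not> martingale M F {0..} X"

primrec drop_time :: "(nat \<Rightarrow> 'a \<Rightarrow> real) \<Rightarrow> nat \<Rightarrow> 'a \<Rightarrow> enat"
where
  "drop_time S 0 \<omega> = 0"
| "drop_time S (Suc k) \<omega> =
     Inf {enat j | j. drop_time S k \<omega> < enat j \<and> S j \<omega> < S (j - 1) \<omega>}"

text \<open>
  \<open>S\<^sub>\<infinity>\<close> is the pathwise \<open>lim\<close>. On the null set where the path diverges this is one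
  fixed unspecified real number, so that \<open>S\<^sub>\<infinity>\<close> is measurable.
\<close>

definition value_at :: "(nat \<Rightarrow> 'a \<Rightarrow> real) \<Rightarrow> ('a \<Rightarrow> enat) \<Rightarrow> 'a \<Rightarrow> real"
where
  "value_at S T \<omega> = (case T \<omega> of enat j \<Rightarrow> S j \<omega> | \<infinity> \<Rightarrow> lim (\<lambda>n. S n \<omega>))"

definition bubble_measure ::
  "'a measure \<Rightarrow> (nat \<Rightarrow> 'a measure) \<Rightarrow> (nat \<Rightarrow> 'a \<Rightarrow> real) \<Rightarrow> bool"
where
  "bubble_measure M G S \<longleftrightarrow>
     martingale M G UNIV S \<and>
     (\<forall>n. \<forall>\<omega>\<in>space M. 0 \<le> S n \<omega>) \<and>
     (\<exists>k\<ge>1. (\<integral>\<omega>. value_at S (drop_time S k) \<omega> \<partial>M) < (\<integral>\<omega>. S 0 \<omega> \<partial>M))"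

definition hitting_time :: "(real \<Rightarrow> 'a \<Rightarrow> real) \<Rightarrow> real \<Rightarrow> 'a \<Rightarrow> ennreal"
where
  "hitting_time X c \<omega> = Inf {ennreal t | t. 0 \<le> t \<and> c \<le> X t \<omega>}"

text \<open>The sequences are indexed from 1; \<open>a 0\<close> and \<open>b 0\<close> are not used.\<close>

definition tau_ab ::
  "(real \<Rightarrow> 'a \<Rightarrow> real) \<Rightarrow> (nat \<Rightarrow> real) \<Rightarrow> (nat \<Rightarrow> real) \<Rightarrow> nat \<Rightarrow> 'a \<Rightarrow> real"
where
  "tau_ab X a b n \<omega> =
     (if n = 0 then 0 else enn2real (min (hitting_time X (b n) \<omega>) (ennreal (a n))))"

definition S_ab ::
  "(real \<Rightarrow> 'a \<Rightarrow> real) \<Rightarrow> (nat \<Rightarrow> real) \<Rightarrow> (nat \<Rightarrow> real) \<Rightarrow> nat \<Rightarrow> 'a \<Rightarrow> real"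
where
  "S_ab X a b n \<omega> = X (tau_ab X a b n \<omega>) \<omega>"

definition F_ab ::
  "'a measure \<Rightarrow> (real \<Rightarrow> 'a measure) \<Rightarrow> (real \<Rightarrow> 'a \<Rightarrow> real) \<Rightarrow>
    (nat \<Rightarrow> real) \<Rightarrow> (nat \<Rightarrow> real) \<Rightarrow> nat \<Rightarrow> 'a measure"
where
  "F_ab M F X a b n = filtration.pre_sigma (space M) F (tau_ab X a b n)"

definition increasing_to_infinity :: "(nat \<Rightarrow> real) \<Rightarrow> bool"
where
  "increasing_to_infinity a \<longleftrightarrow>
     (\<forall>n\<ge>1. 0 < a n) \<and> mono_on {1..} a \<and> filterlim a at_top sequentially"

end

theory Submission
  imports Defs
begin

text \<open>
  Continuous-time optional sampling holds for a nonnegative continuous martingale \<open>Y\<close> and a bounded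
  stopping time: discretize the stopping time from above. Uniform integrability of the sampled
  values is replaced by truncation at a level that bounds the whole approximating sequence. For the
  local martingale \<open>X\<close>, the hitting time of \<open>b\<^sub>n\<close> bounds the path by \<open>b\<^sub>n + X\<^sub>0\<close>, so that the
  localizing sequence can be removed by dominated convergence.

  For a discrete nonnegative martingale \<open>S\<close> tending to \<open>0\<close> and a stopping time \<open>T\<close>,
  the loss \<open>E[S\<^sub>0] - E[S\<^sub>T]\<close> is the limit of \<open>E[S\<^sub>n; T > n]\<close>. If \<open>X\<close> is strict, then
  \<open>E[X\<^sub>t] < E[X\<^sub>0]\<close> for some \<open>t\<close>. Once \<open>a\<^sub>n \<ge> t\<close>, the samples do not drop as long as the
  levels are hit before \<open>t\<close>, and on these events the mass \<open>E[X\<^sub>0] - E[X\<^sub>t]\<close> survives.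

  If \<open>X\<close> is a martingale, sample it along fine partitions of consecutive intervals \<open>[s, t]\<close>, with
  levels so high that \<open>E[X\<^sub>t; level hit before t]\<close> is small. Stopping at the first drop along
  the partition loses almost nothing because the path is continuous. Hence \<open>E[X\<^sub>t; no drop]\<close> is
  at most about \<open>E[X\<^sub>s; X\<^sub>s \<le> X\<^sub>t]\<close>, which is small for large \<open>t\<close> since \<open>X\<^sub>t\<close> tends to \<open>0\<close>.
\<close>

subsection \<open>Martingales and set integrals\<close>

text \<open>A bubble may show at any drop count \<open>k\<close>, while refining a single partition
  controls only its first drop. Hence the bubble-free sampling runs through infinitely many blocks:
  if fewer than \<open>k\<close> drops happen in \<open>k\<close> consecutive blocks, one of these
  blocks has none. Block \<open>j\<close> without a drop carries mass at most
  \<open>2 / (j + 1)\<close>, so the \<open>k\<close> blocks from \<open>J\<close> on carry at most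
  \<open>2 k / (J + 1)\<close>, and \<open>J\<close> can be chosen after \<open>k\<close>. The
  reason why reached levels prevent drops is that the sample then equals the maximum of the level
  and \<open>X 0\<close>, which cannot decrease along increasing levels. This creates the bubble in
  the strict case. In the martingale case it is the obstacle: paths frozen at the level of a block
  never drop inside it. In the strict case nothing is known about the samples before
  \<open>a\<close> has passed the critical time. The drop count is taken so large that all these
  early indices have been used up before the last counted drop.\<close>

lemma set_nn_integral_eq_ennreal:
  fixes f :: "'a \<Rightarrow> real"
  assumes "integrable M f" "A \<in> sets M" "\<And>\<omega>. \<omega> \<in> space M \<Longrightarrow> 0 \<le> f \<omega>"
  shows "(\<integral>\<^sup>+\<omega>\<in>A. ennreal (f \<omega>) \<partial>M) = ennreal (\<integral>\<omega>\<in>A. f \<omega> \<partial>M)"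
    and "0 \<le> (\<integral>\<omega>\<in>A. f \<omega> \<partial>M)"
proof -
  have "(\<integral>\<^sup>+\<omega>\<in>A. ennreal (f \<omega>) \<partial>M) = (\<integral>\<^sup>+\<omega>. ennreal (indicator A \<omega> *\<^sub>R f \<omega>) \<partial>M)"
    by (intro nn_integral_cong) (auto split: split_indicator)
  also have "\<dots> = ennreal (\<integral>\<omega>\<in>A. f \<omega> \<partial>M)"
    unfolding set_lebesgue_integral_def
    using assms by (intro nn_integral_eq_integral integrable_mult_indicator)
      (auto split: split_indicator)
  finally show "(\<integral>\<^sup>+\<omega>\<in>A. ennreal (f \<omega>) \<partial>M) = ennreal (\<integral>\<omega>\<in>A. f \<omega> \<partial>M)" .
  show "0 \<le> (\<integral>\<omega>\<in>A. f \<omega> \<partial>M)"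
    unfolding set_lebesgue_integral_def
    using assms by (intro integral_nonneg_AE) (auto split: split_indicator)
qed

lemma (in filtration) measurable_F_mono:
  "f \<in> measurable (F s) N \<Longrightarrow> s \<le> t \<Longrightarrow> f \<in> measurable (F t) N"
  by (rule measurable_from_subalg[of "F t" "F s"])
    (use sets_F_mono[of s t] in \<open>simp_all add: subalgebra_def space_F\<close>)

lemma (in filtered_prob_space) sigma_finite_subalgebra_F: "sigma_finite_subalgebra M (F t)"
proof -
  have "subalgebra M (F t)"
    unfolding subalgebra_def using sets_F_subset[of t] space_F[of t] by blast
  then have "finite_measure_subalgebra M (F t)"
    by (rule finite_measure_subalgebra.intro[OF finite_measure_axioms
          finite_measure_subalgebra_axioms.intro])
  then show ?thesis
    by (rule finite_measure_subalgebra_is_sigma_finite)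
qed

lemma (in filtered_prob_space) measurable_F_imp_M:
  "f \<in> measurable (F t) N \<Longrightarrow> f \<in> measurable M N"
  by (rule measurable_from_subalg[of M "F t"])
    (use sets_F_subset[of t] space_F[of t] in \<open>simp_all add: subalgebra_def\<close>)

text \<open>Integrals over past events replace conditional expectations from here on. In
  \<open>ennreal\<close> form, Fatou, monotone convergence and countable sums apply without
  integrability conditions.\<close>

lemma martingale_set_nn_integral:
  assumes Y: "martingale M F I Y" and st: "s \<in> I" "t \<in> I" "s \<le> t"
    and nonneg: "\<And>t \<omega>. t \<in> I \<Longrightarrow> \<omega> \<in> space M \<Longrightarrow> 0 \<le> Y t \<omega>" and A: "A \<in> sets (F s)"
  shows "(\<integral>\<^sup>+\<omega>\<in>A. ennreal (Y s \<omega>) \<partial>M) = (\<integral>\<^sup>+\<omega>\<in>A. ennreal (Y t \<omega>) \<partial>M)"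
proof -
  interpret filtered_prob_space M F using Y by (simp add: martingale_def)
  interpret S: sigma_finite_subalgebra M "F s" by (rule sigma_finite_subalgebra_F)
  have AM: "A \<in> sets M" using A sets_F_subset by auto
  have int: "integrable M (Y s)" "integrable M (Y t)" using Y st by (auto simp: martingale_def)
  have [measurable]: "Y s \<in> borel_measurable M" using int(1) by simp
  have ae: "AE \<omega> in M. real_cond_exp M (F s) (Y t) \<omega> = Y s \<omega>"
    using Y st by (auto simp: martingale_def)
  have "(\<integral>\<omega>\<in>A. Y t \<omega> \<partial>M) = (\<integral>\<omega>\<in>A. real_cond_exp M (F s) (Y t) \<omega> \<partial>M)"
    using int A by (intro S.real_cond_exp_intA)
  also have "\<dots> = (\<integral>\<omega>\<in>A. Y s \<omega> \<partial>M)"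
    using ae AM int by (intro set_lebesgue_integral_cong_AE) auto
  finally show ?thesis
    using int AM nonneg st by (simp add: set_nn_integral_eq_ennreal)
qed

lemma martingaleI_set_nn_integral:
  assumes "filtered_prob_space M F"
    and adapted: "\<And>t. t \<in> I \<Longrightarrow> Y t \<in> borel_measurable (F t)"
    and int: "\<And>t. t \<in> I \<Longrightarrow> integrable M (Y t)"
    and nonneg: "\<And>t \<omega>. t \<in> I \<Longrightarrow> \<omega> \<in> space M \<Longrightarrow> 0 \<le> Y t \<omega>"
    and eq: "\<And>s t A. s \<in> I \<Longrightarrow> t \<in> I \<Longrightarrow> s \<le> t \<Longrightarrow> A \<in> sets (F s) \<Longrightarrow>
      (\<integral>\<^sup>+\<omega>\<in>A. ennreal (Y s \<omega>) \<partial>M) = (\<integral>\<^sup>+\<omega>\<in>A. ennreal (Y t \<omega>) \<partial>M)"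
  shows "martingale M F I Y"
proof -
  interpret filtered_prob_space M F by fact
  have "AE \<omega> in M. real_cond_exp M (F s) (Y t) \<omega> = Y s \<omega>" if st: "s \<in> I" "t \<in> I" "s \<le> t" for s t
  proof -
    interpret S: sigma_finite_subalgebra M "F s" by (rule sigma_finite_subalgebra_F)
    show ?thesis
    proof (rule S.real_cond_exp_charact)
      fix A assume A: "A \<in> sets (F s)"
      have AM: "A \<in> sets M" using A sets_F_subset by auto
      show "(\<integral>\<omega>\<in>A. Y t \<omega> \<partial>M) = (\<integral>\<omega>\<in>A. Y s \<omega> \<partial>M)"
        using eq[OF st A] int[OF st(1)] int[OF st(2)] AM nonneg st
        by (simp add: set_nn_integral_eq_ennreal)
    qed (use st int adapted in auto)
  qed
  then show ?thesis
    using assms by (auto simp: martingale_def)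
qed

text \<open>On the part of \<open>A\<close> where \<open>\<kappa>\<close> equals \<open>k\<close>
  the sampled time is the constant \<open>r k\<close>, and this part belongs to
  \<open>F (r k)\<close>. The martingale identity holds on each part, and the parts are
  summed.\<close>

lemma optional_sampling_countable:
  fixes \<kappa> :: "'a \<Rightarrow> nat"
  assumes Y: "martingale M F I Y"
    and nonneg: "\<And>t \<omega>. t \<in> I \<Longrightarrow> \<omega> \<in> space M \<Longrightarrow> 0 \<le> Y t \<omega>"
    and r: "\<And>k. r k \<in> I" "\<And>k. r k \<le> T" and T: "T \<in> I"
    and A: "\<And>k. {\<omega>\<in>A. \<kappa> \<omega> = k} \<in> sets (F (r k))"
  shows "(\<integral>\<^sup>+\<omega>\<in>A. ennreal (Y (r (\<kappa> \<omega>)) \<omega>) \<partial>M) = (\<integral>\<^sup>+\<omega>\<in>A. ennreal (Y T \<omega>) \<partial>M)"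
proof -
  interpret filtered_prob_space M F using Y by (simp add: martingale_def)
  define B where "B k = {\<omega>\<in>A. \<kappa> \<omega> = k}" for k
  have B: "B k \<in> sets (F (r k))" "B k \<in> sets M" for k
    using A[of k] sets_F_subset[of "r k"] by (auto simp: B_def)
  have [measurable]: "B k \<in> sets M" for k by (rule B)
  have [measurable]: "Y (r k) \<in> borel_measurable M" "Y T \<in> borel_measurable M" for k
    using Y r T by (auto simp: martingale_def)
  have sum_fibres: "(\<integral>\<^sup>+\<omega>\<in>A. g (\<kappa> \<omega>) \<omega> \<partial>M) = (\<Sum>k. \<integral>\<^sup>+\<omega>\<in>B k. g k \<omega> \<partial>M)"
    if [measurable]: "\<And>k. g k \<in> borel_measurable M" for g :: "nat \<Rightarrow> 'a \<Rightarrow> ennreal"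
  proof -
    have "g (\<kappa> \<omega>) \<omega> * indicator A \<omega> = (\<Sum>k. g k \<omega> * indicator (B k) \<omega>)" for \<omega>
    proof -
      have "(\<Sum>k. g k \<omega> * indicator (B k) \<omega>) = (\<Sum>k\<in>{\<kappa> \<omega>}. g k \<omega> * indicator (B k) \<omega>)"
        by (intro suminf_finite) (auto simp: B_def)
      also have "\<dots> = g (\<kappa> \<omega>) \<omega> * indicator A \<omega>"
        by (simp add: B_def indicator_def)
      finally show ?thesis by (rule sym)
    qed
    then have "(\<integral>\<^sup>+\<omega>\<in>A. g (\<kappa> \<omega>) \<omega> \<partial>M) = (\<integral>\<^sup>+\<omega>. (\<Sum>k. g k \<omega> * indicator (B k) \<omega>) \<partial>M)"
      by simp
    also have "\<dots> = (\<Sum>k. \<integral>\<^sup>+\<omega>\<in>B k. g k \<omega> \<partial>M)"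
      by (intro nn_integral_suminf) measurable
    finally show ?thesis .
  qed
  have "(\<integral>\<^sup>+\<omega>\<in>B k. ennreal (Y (r k) \<omega>) \<partial>M) = (\<integral>\<^sup>+\<omega>\<in>B k. ennreal (Y T \<omega>) \<partial>M)" for k
    by (rule martingale_set_nn_integral[OF Y r(1) T r(2) nonneg B(1)])
  then show ?thesis
    using sum_fibres[of "\<lambda>k \<omega>. ennreal (Y (r k) \<omega>)"] sum_fibres[of "\<lambda>k \<omega>. ennreal (Y T \<omega>)"]
    by simp
qed

subsection \<open>Optional sampling of continuous martingales\<close>

text \<open>Progressive measurability of a continuous adapted process, proved for the stopping time
  capped at \<open>t\<close> and then transferred to the pre-sigma-algebra.\<close>

lemma borel_measurable_stopped:
  fixes F :: "real \<Rightarrow> 'a measure" and X :: "real \<Rightarrow> 'a \<Rightarrow> real"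
  assumes F: "filtration \<Omega> F"
    and adapted: "\<And>t. 0 \<le> t \<Longrightarrow> X t \<in> borel_measurable (F t)"
    and cont: "\<And>\<omega>. \<omega> \<in> \<Omega> \<Longrightarrow> continuous_on {0..} (\<lambda>t. X t \<omega>)"
    and \<tau>: "stopping_time F \<tau>" and nonneg: "\<And>\<omega>. \<omega> \<in> \<Omega> \<Longrightarrow> 0 \<le> \<tau> \<omega>"
  shows "(\<lambda>\<omega>. X (\<tau> \<omega>) \<omega>) \<in> borel_measurable (filtration.pre_sigma \<Omega> F \<tau>)"
proof -
  interpret filtration \<Omega> F by fact
  have main: "(\<lambda>\<omega>. X (min t (\<tau> \<omega>)) \<omega>) \<in> borel_measurable (F t)" if "0 \<le> t" for t
  proof -
    \<comment> \<open>Rounding down keeps the evaluation times at most \<open>t\<close>, so every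
      approximation is measurable with respect to \<open>F t\<close>; path continuity passes this on
      to the limit.\<close>
    define d where "d n u = min t (real (nat \<lfloor>real (Suc n) * u\<rfloor>) / real (Suc n))" for n :: nat and u
    have [measurable]: "(\<lambda>\<omega>. min t (\<tau> \<omega>)) \<in> borel_measurable (F t)"
    proof (rule borel_measurableI_le)
      fix s
      have "{\<omega> \<in> space (F t). \<tau> \<omega> \<le> s} \<in> sets (F t)" if "s < t"
        using stopping_time_le_const[OF \<tau>, of s t] that by (simp add: pred_def)
      then show "{\<omega> \<in> space (F t). min t (\<tau> \<omega>) \<le> s} \<in> sets (F t)"
        by (cases "s < t") (auto simp: min_le_iff_disj)
    qed
    have meas: "(\<lambda>\<omega>. X (d n (min t (\<tau> \<omega>))) \<omega>) \<in> borel_measurable (F t)" for n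
      unfolding d_def
    proof (rule measurable_compose_countable[where g = "\<lambda>\<omega>. nat \<lfloor>real (Suc n) * min t (\<tau> \<omega>)\<rfloor>"])
      show "(\<lambda>\<omega>. X (min t (real k / real (Suc n))) \<omega>) \<in> borel_measurable (F t)" for k
        using \<open>0 \<le> t\<close> by (intro measurable_F_mono[OF adapted]) auto
    qed measurable
    show ?thesis
    proof (rule borel_measurable_LIMSEQ_real[OF _ meas])
      fix \<omega> assume "\<omega> \<in> space (F t)"
      then have \<omega>: "\<omega> \<in> \<Omega>" by (simp add: space_F)
      define u where "u = min t (\<tau> \<omega>)"
      have u: "0 \<le> u" "u \<le> t" using nonneg[OF \<omega>] \<open>0 \<le> t\<close> by (auto simp: u_def)
      have bounds: "u - 1 / real (Suc n) \<le> d n u \<and> d n u \<le> u" for n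
      proof -
        have "real (Suc n) * u - 1 \<le> real (nat \<lfloor>real (Suc n) * u\<rfloor>)"
             "real (nat \<lfloor>real (Suc n) * u\<rfloor>) \<le> real (Suc n) * u"
          using u by (auto intro!: of_nat_floor)
        then have "(real (Suc n) * u - 1) / real (Suc n) \<le> real (nat \<lfloor>real (Suc n) * u\<rfloor>) / real (Suc n)"
             "real (nat \<lfloor>real (Suc n) * u\<rfloor>) / real (Suc n) \<le> real (Suc n) * u / real (Suc n)"
          by (intro divide_right_mono; simp)+
        then have "u - 1 / real (Suc n) \<le> real (nat \<lfloor>real (Suc n) * u\<rfloor>) / real (Suc n)"
             "real (nat \<lfloor>real (Suc n) * u\<rfloor>) / real (Suc n) \<le> u"
          by (simp_all add: diff_divide_distrib del: of_nat_Suc)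
        then show ?thesis using u by (auto simp: d_def min_def)
      qed
      have "(\<lambda>n. d n u) \<longlonglongrightarrow> u"
      proof (rule tendsto_sandwich[where h = "\<lambda>_. u"])
        show "(\<lambda>n. u - 1 / real (Suc n)) \<longlonglongrightarrow> u"
          using tendsto_diff[OF tendsto_const LIMSEQ_inverse_real_of_nat, of u]
          by (simp add: inverse_eq_divide)
      qed (use bounds in auto)
      moreover have "d n u \<in> {0..}" for n
        using \<open>0 \<le> t\<close> by (simp add: d_def)
      ultimately have "(\<lambda>n. X (d n u) \<omega>) \<longlonglongrightarrow> X u \<omega>"
        using u by (intro continuous_on_tendsto_compose[OF cont[OF \<omega>]]) auto
      then show "(\<lambda>n. X (d n (min t (\<tau> \<omega>))) \<omega>) \<longlonglongrightarrow> X (min t (\<tau> \<omega>)) \<omega>"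
        by (simp add: u_def)
    qed
  qed
  show ?thesis
  proof (intro borel_measurableI_le sets_pre_sigmaI[OF \<tau>])
    fix c t
    show "{\<omega> \<in> {\<omega> \<in> space (pre_sigma \<tau>). X (\<tau> \<omega>) \<omega> \<le> c}. \<tau> \<omega> \<le> t} \<in> sets (F t)"
    proof (cases "0 \<le> t")
      case True
      have "{\<omega> \<in> space (F t). \<tau> \<omega> \<le> t} \<in> sets (F t)"
        using stopping_timeD[OF \<tau>, of t] by (simp add: pred_def)
      moreover have "{\<omega> \<in> space (F t). X (min t (\<tau> \<omega>)) \<omega> \<le> c} \<in> sets (F t)"
        using main[OF True] by measurable
      ultimately have "{\<omega> \<in> space (F t). X (min t (\<tau> \<omega>)) \<omega> \<le> c} \<inter> {\<omega> \<in> space (F t). \<tau> \<omega> \<le> t} \<in> sets (F t)"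
        by auto
      \<comment> \<open>Where \<open>\<tau> \<omega> \<le> t\<close>, the cap at \<open>t\<close>
        does not change the time.\<close>
      also have "{\<omega> \<in> space (F t). X (min t (\<tau> \<omega>)) \<omega> \<le> c} \<inter> {\<omega> \<in> space (F t). \<tau> \<omega> \<le> t} =
        {\<omega> \<in> {\<omega> \<in> space (pre_sigma \<tau>). X (\<tau> \<omega>) \<omega> \<le> c}. \<tau> \<omega> \<le> t}"
        by (auto simp: space_F space_pre_sigma min_def split: if_splits)
      finally show ?thesis .
    next
      case False
      then have "{\<omega> \<in> {\<omega> \<in> space (pre_sigma \<tau>). X (\<tau> \<omega>) \<omega> \<le> c}. \<tau> \<omega> \<le> t} = {}"
        using nonneg by (fastforce simp: space_pre_sigma)
      then show ?thesis by (metis sets.empty_sets)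
    qed
  qed
qed

lemma (in filtered_prob_space) pre_sigma_subset_sets:
  fixes \<tau> :: "'a \<Rightarrow> 't"
  assumes \<tau>: "stopping_time F \<tau>" and T: "\<And>\<omega>. \<omega> \<in> space M \<Longrightarrow> \<tau> \<omega> \<le> T"
  shows "sets (pre_sigma \<tau>) \<subseteq> sets (F T)"
proof
  fix A assume A: "A \<in> sets (pre_sigma \<tau>)"
  then have "A \<subseteq> space M" using sets.sets_into_space[OF A] by (simp add: space_pre_sigma)
  then have "{\<omega>\<in>A. \<tau> \<omega> \<le> T} = A" using T by auto
  then show "A \<in> sets (F T)" using sets_pre_sigmaD[OF \<tau> A, of T] by simp
qed

text \<open>Fatou gives one inequality for the discretized times, truncation the other. The set
  \<open>A\<close> is general because hitting events have to be sampled later.\<close>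

lemma optional_sampling_continuous:
  fixes F :: "real \<Rightarrow> 'a measure" and Y :: "real \<Rightarrow> 'a \<Rightarrow> real"
  assumes Y: "martingale M F {0..} Y"
    and nonneg: "\<And>t \<omega>. 0 \<le> t \<Longrightarrow> \<omega> \<in> space M \<Longrightarrow> 0 \<le> Y t \<omega>"
    and cont: "\<And>\<omega>. \<omega> \<in> space M \<Longrightarrow> continuous_on {0..} (\<lambda>t. Y t \<omega>)"
    and \<tau>: "stopping_time F \<tau>"
    and bounds: "\<And>\<omega>. \<omega> \<in> space M \<Longrightarrow> 0 \<le> \<tau> \<omega>" "\<And>\<omega>. \<omega> \<in> space M \<Longrightarrow> \<tau> \<omega> \<le> T" "0 \<le> T"
    and A: "A \<in> sets (filtration.pre_sigma (space M) F \<tau>)"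
  shows "(\<integral>\<^sup>+\<omega>\<in>A. ennreal (Y (\<tau> \<omega>) \<omega>) \<partial>M) = (\<integral>\<^sup>+\<omega>\<in>A. ennreal (Y T \<omega>) \<partial>M)"
proof -
  interpret filtered_prob_space M F using Y by (simp add: martingale_def)
  have adapted: "0 \<le> t \<Longrightarrow> Y t \<in> borel_measurable (F t)" for t
    using Y by (auto simp: martingale_def)
  have [measurable]: "Y T \<in> borel_measurable M"
    using adapted[of T] bounds by (auto intro: measurable_F_imp_M)
  have [measurable]: "A \<in> sets M"
    using A pre_sigma_subset_sets[OF \<tau> bounds(2)] sets_F_subset by blast
  have A_space: "\<omega> \<in> A \<Longrightarrow> \<omega> \<in> space M" for \<omega>
    using sets.sets_into_space[OF A] by (auto simp: space_pre_sigma)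
  have [measurable]: "\<tau> \<in> borel_measurable M"
    using sets_F_subset space_F by (intro measurable_stopping_time[OF \<tau>])
  \<comment> \<open>Rounding up makes the discretized time a stopping time:
    \<open>\<kappa> n \<omega> \<le> k\<close> means \<open>\<tau> \<omega> \<le> r n k\<close>, an
    event known at \<open>r n k\<close>. The cap at \<open>T\<close> keeps this equivalence because
    \<open>\<tau>\<close> never exceeds \<open>T\<close>.\<close>
  define \<kappa> where "\<kappa> n \<omega> = nat \<lceil>real (Suc n) * \<tau> \<omega>\<rceil>" for n \<omega>
  define r where "r n k = min T (real k / real (Suc n))" for n k :: nat
  define Z where "Z n \<omega> = Y (r n (\<kappa> n \<omega>)) \<omega>" for n \<omega>
  have r: "r n k \<in> {0..}" "r n k \<le> T" for n k
    using bounds by (auto simp: r_def)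
  have Z_meas[measurable]: "Z n \<in> borel_measurable M" for n
    unfolding Z_def
  proof (rule measurable_compose_countable)
    show "Y (r n k) \<in> borel_measurable M" for k
      using adapted[of "r n k"] r by (auto intro: measurable_F_imp_M)
    show "\<kappa> n \<in> measurable M (count_space UNIV)"
      unfolding \<kappa>_def by measurable
  qed
  have Z_nonneg: "\<omega> \<in> space M \<Longrightarrow> 0 \<le> Z n \<omega>" for n \<omega>
    using r nonneg by (auto simp: Z_def)
  have \<kappa>_le: "\<kappa> n \<omega> \<le> k \<longleftrightarrow> \<tau> \<omega> \<le> r n k" if "\<omega> \<in> space M" for n k \<omega>
  proof -
    have "\<kappa> n \<omega> \<le> k \<longleftrightarrow> real (Suc n) * \<tau> \<omega> \<le> real k"
      unfolding \<kappa>_def by (simp add: nat_le_iff ceiling_le_iff)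
    also have "\<dots> \<longleftrightarrow> \<tau> \<omega> \<le> real k / real (Suc n)"
      by (simp add: field_simps del: of_nat_Suc)
    finally show ?thesis using bounds(2)[OF that] by (simp add: r_def)
  qed
  have "mono (r n)" for n
    by (auto simp: mono_def r_def divide_right_mono intro: min.coboundedI2)
  then have \<kappa>_eq_sets: "{\<omega>\<in>A. \<kappa> n \<omega> = k} \<in> sets (F (r n k))" for n k
  proof (cases k)
    case 0
    have "{\<omega>\<in>A. \<kappa> n \<omega> = k} = {\<omega>\<in>A. \<tau> \<omega> \<le> r n k}"
      using \<kappa>_le[of _ n k] A_space 0 by auto
    then show ?thesis using sets_pre_sigmaD[OF \<tau> A, of "r n k"] by simp
  next
    case (Suc k')
    have "{\<omega>\<in>A. \<kappa> n \<omega> = k} = {\<omega>\<in>A. \<kappa> n \<omega> \<le> k} - {\<omega>\<in>A. \<kappa> n \<omega> \<le> k'}"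
      using Suc by auto
    then have "{\<omega>\<in>A. \<kappa> n \<omega> = k} = {\<omega>\<in>A. \<tau> \<omega> \<le> r n k} - {\<omega>\<in>A. \<tau> \<omega> \<le> r n k'}"
      using \<kappa>_le[of _ n k] \<kappa>_le[of _ n k'] A_space by auto
    moreover have "{\<omega>\<in>A. \<tau> \<omega> \<le> r n k'} \<in> sets (F (r n k))"
      using sets_pre_sigmaD[OF \<tau> A, of "r n k'"] sets_F_mono[of "r n k'" "r n k"]
        monoD[OF \<open>mono (r n)\<close>, of k' k] Suc by auto
    ultimately show ?thesis using sets_pre_sigmaD[OF \<tau> A, of "r n k"] by auto
  qed
  have Z_lim: "(\<lambda>n. Z n \<omega>) \<longlonglongrightarrow> Y (\<tau> \<omega>) \<omega>" if \<omega>: "\<omega> \<in> space M" for \<omega>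
  proof -
    have *: "\<tau> \<omega> \<le> r n (\<kappa> n \<omega>) \<and> r n (\<kappa> n \<omega>) \<le> \<tau> \<omega> + 1 / real (Suc n)" for n
    proof -
      have "real (\<kappa> n \<omega>) \<le> real (Suc n) * \<tau> \<omega> + 1"
        using bounds(1)[OF \<omega>] of_int_ceiling_le_add_one[of "real (Suc n) * \<tau> \<omega>"]
        unfolding \<kappa>_def by simp
      then have "real (\<kappa> n \<omega>) / real (Suc n) \<le> \<tau> \<omega> + 1 / real (Suc n)"
        by (simp add: field_simps del: of_nat_Suc)
      then show ?thesis
        using \<kappa>_le[OF \<omega>, of n "\<kappa> n \<omega>"] by (auto simp: r_def)
    qed
    have "(\<lambda>n. r n (\<kappa> n \<omega>)) \<longlonglongrightarrow> \<tau> \<omega>"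
    proof (rule tendsto_sandwich[where f = "\<lambda>_. \<tau> \<omega>"])
      show "(\<lambda>n. \<tau> \<omega> + 1 / real (Suc n)) \<longlonglongrightarrow> \<tau> \<omega>"
        using tendsto_add[OF tendsto_const LIMSEQ_inverse_real_of_nat, of "\<tau> \<omega>"]
        by (simp add: inverse_eq_divide)
    qed (use * in auto)
    then show ?thesis
      unfolding Z_def using r bounds(1)[OF \<omega>]
      by (intro continuous_on_tendsto_compose[OF cont[OF \<omega>]]) auto
  qed
  have Y\<tau>_meas[measurable]: "(\<lambda>\<omega>. Y (\<tau> \<omega>) \<omega>) \<in> borel_measurable M"
    by (rule borel_measurable_LIMSEQ_real[OF Z_lim Z_meas])
  \<comment> \<open>A condition on the sampled value is allowed since on
    \<open>\<kappa> n \<omega> = k\<close> it concerns \<open>Y (r n k)\<close>. It is taken trivial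
    for Fatou and as a bound by \<open>K\<close> for the truncation.\<close>
  have sampling: "(\<integral>\<^sup>+\<omega>\<in>{\<omega>\<in>A. P (Z n \<omega>)}. ennreal (Z n \<omega>) \<partial>M) = (\<integral>\<^sup>+\<omega>\<in>{\<omega>\<in>A. P (Z n \<omega>)}. ennreal (Y T \<omega>) \<partial>M)"
    if [measurable]: "Measurable.pred borel P" for P n
    unfolding Z_def
  proof (rule optional_sampling_countable[OF Y])
    fix k
    have [measurable]: "Y (r n k) \<in> borel_measurable (F (r n k))"
      using r adapted by auto
    have "{\<omega>\<in>space (F (r n k)). P (Y (r n k) \<omega>)} \<in> sets (F (r n k))"
      by measurable
    then have "{\<omega>\<in>A. \<kappa> n \<omega> = k} \<inter> {\<omega>\<in>space (F (r n k)). P (Y (r n k) \<omega>)} \<in> sets (F (r n k))"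
      using \<kappa>_eq_sets by auto
    also have "{\<omega>\<in>A. \<kappa> n \<omega> = k} \<inter> {\<omega>\<in>space (F (r n k)). P (Y (r n k) \<omega>)} =
      {\<omega> \<in> {\<omega> \<in> A. P (Y (r n (\<kappa> n \<omega>)) \<omega>)}. \<kappa> n \<omega> = k}"
      using A_space by (auto simp: space_F)
    finally show "{\<omega> \<in> {\<omega> \<in> A. P (Y (r n (\<kappa> n \<omega>)) \<omega>)}. \<kappa> n \<omega> = k} \<in> sets (F (r n k))" .
  qed (use r nonneg bounds in auto)
  show ?thesis
  proof (rule antisym)
    have "(\<integral>\<^sup>+\<omega>\<in>A. ennreal (Y (\<tau> \<omega>) \<omega>) \<partial>M) = (\<integral>\<^sup>+\<omega>. liminf (\<lambda>n. ennreal (Z n \<omega>) * indicator A \<omega>) \<partial>M)"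
    proof (intro nn_integral_cong)
      fix \<omega> assume "\<omega> \<in> space M"
      have "(\<lambda>n. ennreal (Z n \<omega>) * indicator A \<omega>) \<longlonglongrightarrow> ennreal (Y (\<tau> \<omega>) \<omega>) * indicator A \<omega>"
        using Z_lim[OF \<open>\<omega> \<in> space M\<close>] by (auto split: split_indicator intro: tendsto_ennrealI)
      then show "ennreal (Y (\<tau> \<omega>) \<omega>) * indicator A \<omega> = liminf (\<lambda>n. ennreal (Z n \<omega>) * indicator A \<omega>)"
        by (simp add: lim_imp_Liminf)
    qed
    also have "\<dots> \<le> liminf (\<lambda>n. \<integral>\<^sup>+\<omega>\<in>A. ennreal (Z n \<omega>) \<partial>M)"
      by (intro nn_integral_liminf) measurable
    also have "\<dots> = (\<integral>\<^sup>+\<omega>\<in>A. ennreal (Y T \<omega>) \<partial>M)"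
      using sampling[of "\<lambda>_. True"] by (simp add: Liminf_const)
    finally show "(\<integral>\<^sup>+\<omega>\<in>A. ennreal (Y (\<tau> \<omega>) \<omega>) \<partial>M) \<le> (\<integral>\<^sup>+\<omega>\<in>A. ennreal (Y T \<omega>) \<partial>M)" .
  next
    \<comment> \<open>On \<open>B K\<close> every approximation is at most \<open>K\<close>, so
      E[Y_T; B_K] is at most E[Z_n; Z_n at most K] and hence at most the integral of
      \<open>min (Z n \<omega>) (real K)\<close>. This integrand is bounded, so its limit in
      \<open>n\<close> may be taken inside.\<close>
    define B where "B K = {\<omega>\<in>A. \<forall>n. Z n \<omega> \<le> real K}" for K :: nat
    have [measurable]: "B K \<in> sets M" for K
      unfolding B_def by measurable
    have "(\<integral>\<^sup>+\<omega>\<in>B K. ennreal (Y T \<omega>) \<partial>M) \<le> (\<integral>\<^sup>+\<omega>\<in>A. ennreal (Y (\<tau> \<omega>) \<omega>) \<partial>M)" for K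
    proof -
      have le: "(\<integral>\<^sup>+\<omega>\<in>B K. ennreal (Y T \<omega>) \<partial>M) \<le> (\<integral>\<^sup>+\<omega>\<in>A. ennreal (min (Z n \<omega>) (real K)) \<partial>M)" for n
      proof -
        have "(\<integral>\<^sup>+\<omega>\<in>B K. ennreal (Y T \<omega>) \<partial>M) \<le> (\<integral>\<^sup>+\<omega>\<in>{\<omega>\<in>A. Z n \<omega> \<le> real K}. ennreal (Y T \<omega>) \<partial>M)"
          by (intro nn_integral_mono) (auto simp: B_def split: split_indicator)
        also have "\<dots> = (\<integral>\<^sup>+\<omega>\<in>{\<omega>\<in>A. Z n \<omega> \<le> real K}. ennreal (Z n \<omega>) \<partial>M)"
          by (rule sampling[symmetric]) measurable
        also have "\<dots> \<le> (\<integral>\<^sup>+\<omega>\<in>A. ennreal (min (Z n \<omega>) (real K)) \<partial>M)"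
          by (intro nn_integral_mono) (auto split: split_indicator)
        finally show ?thesis .
      qed
      have "(\<lambda>n. \<integral>\<^sup>+\<omega>\<in>A. ennreal (min (Z n \<omega>) (real K)) \<partial>M) \<longlonglongrightarrow>
        (\<integral>\<^sup>+\<omega>\<in>A. ennreal (min (Y (\<tau> \<omega>) \<omega>) (real K)) \<partial>M)"
      proof (rule nn_integral_dominated_convergence[where w = "\<lambda>_. ennreal (real K)"])
        show "AE \<omega> in M. (\<lambda>n. ennreal (min (Z n \<omega>) (real K)) * indicator A \<omega>) \<longlonglongrightarrow>
          ennreal (min (Y (\<tau> \<omega>) \<omega>) (real K)) * indicator A \<omega>"
          using Z_lim by (auto split: split_indicator intro!: AE_I2 tendsto_ennrealI tendsto_min)
        show "(\<integral>\<^sup>+\<omega>. ennreal (real K) \<partial>M) < \<infinity>"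
          by (simp add: emeasure_space_1)
      qed (auto split: split_indicator intro!: AE_I2 ennreal_leI)
      then have "(\<integral>\<^sup>+\<omega>\<in>B K. ennreal (Y T \<omega>) \<partial>M) \<le> (\<integral>\<^sup>+\<omega>\<in>A. ennreal (min (Y (\<tau> \<omega>) \<omega>) (real K)) \<partial>M)"
        using le by (intro LIMSEQ_le_const) auto
      also have "\<dots> \<le> (\<integral>\<^sup>+\<omega>\<in>A. ennreal (Y (\<tau> \<omega>) \<omega>) \<partial>M)"
        by (intro nn_integral_mono) (auto split: split_indicator intro!: ennreal_leI)
      finally show ?thesis .
    qed
    moreover have "(SUP K. \<integral>\<^sup>+\<omega>\<in>B K. ennreal (Y T \<omega>) \<partial>M) = (\<integral>\<^sup>+\<omega>\<in>A. ennreal (Y T \<omega>) \<partial>M)"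
    proof -
      have "(\<integral>\<^sup>+\<omega>\<in>A. ennreal (Y T \<omega>) \<partial>M) = (\<integral>\<^sup>+\<omega>. (SUP K. ennreal (Y T \<omega>) * indicator (B K) \<omega>) \<partial>M)"
      proof (intro nn_integral_cong antisym)
        fix \<omega> assume \<omega>: "\<omega> \<in> space M"
        \<comment> \<open>A convergent sequence is bounded, so the sets \<open>B K\<close> exhaust
          \<open>A\<close> as \<open>K\<close> grows.\<close>
        obtain C where C: "\<And>n. Z n \<omega> \<le> C"
          using convergent_imp_Bseq[OF convergentI[OF Z_lim[OF \<omega>]]]
          unfolding Bseq_def by (metis abs_le_D1 real_norm_def)
        obtain K :: nat where "C \<le> real K" using real_arch_simple by auto
        then have "\<And>n. Z n \<omega> \<le> real K" using C order_trans by blast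
        then have "indicator A \<omega> = (indicator (B K) \<omega> :: ennreal)"
          by (auto simp: B_def split: split_indicator)
        then show "ennreal (Y T \<omega>) * indicator A \<omega> \<le> (SUP K. ennreal (Y T \<omega>) * indicator (B K) \<omega>)"
          by (intro SUP_upper2[of K]) auto
        show "(SUP K. ennreal (Y T \<omega>) * indicator (B K) \<omega>) \<le> ennreal (Y T \<omega>) * indicator A \<omega>"
          by (intro SUP_least) (auto simp: B_def split: split_indicator)
      qed
      also have "\<dots> = (SUP K. \<integral>\<^sup>+\<omega>\<in>B K. ennreal (Y T \<omega>) \<partial>M)"
      proof (rule nn_integral_monotone_convergence_SUP)
        show "incseq (\<lambda>K \<omega>. ennreal (Y T \<omega>) * indicator (B K) \<omega>)"
        proof (intro incseq_SucI le_funI mult_left_mono)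
          fix K \<omega>
          have "B K \<subseteq> B (Suc K)"
            unfolding B_def by (smt (verit) Collect_mono of_nat_Suc)
          then show "(indicator (B K) \<omega> :: ennreal) \<le> indicator (B (Suc K)) \<omega>"
            by (auto split: split_indicator)
        qed simp
      qed measurable
      finally show ?thesis by simp
    qed
    ultimately show "(\<integral>\<^sup>+\<omega>\<in>A. ennreal (Y T \<omega>) \<partial>M) \<le> (\<integral>\<^sup>+\<omega>\<in>A. ennreal (Y (\<tau> \<omega>) \<omega>) \<partial>M)"
      using SUP_least[of UNIV "\<lambda>K. \<integral>\<^sup>+\<omega>\<in>B K. ennreal (Y T \<omega>) \<partial>M"] by metis
  qed
qed

subsection \<open>Positive continuous local martingales\<close>

locale positive_continuous_local_martingale = filtered_prob_space M F
  for M :: "'a measure" and F :: "real \<Rightarrow> 'a measure" +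
  fixes X :: "real \<Rightarrow> 'a \<Rightarrow> real"
  assumes local_mart: "local_martingale M F X"
    and cont: "\<And>\<omega>. \<omega> \<in> space M \<Longrightarrow> continuous_on {0..} (\<lambda>t. X t \<omega>)"
    and pos: "\<And>t \<omega>. 0 \<le> t \<Longrightarrow> \<omega> \<in> space M \<Longrightarrow> 0 < X t \<omega>"
begin

lemma adapted: "0 \<le> t \<Longrightarrow> X t \<in> borel_measurable (F t)"
  using local_mart by (simp add: local_martingale_def)

lemma measurable_X: "0 \<le> t \<Longrightarrow> X t \<in> borel_measurable M"
  by (rule measurable_F_imp_M[OF adapted])

text \<open>Since \<open>enn2real\<close> sends \<open>\<top>\<close> to 0, the minimum can be
  pulled out of it only for a finite stopping time.\<close>

lemma stopped_process_eq:
  assumes "0 \<le> t"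
  shows "stopped_process X \<sigma> t \<omega> = X (if \<sigma> \<omega> = \<top> then t else min (enn2real (\<sigma> \<omega>)) t) \<omega>"
proof (cases "\<sigma> \<omega>")
  case (real x)
  then show ?thesis using assms by (simp add: stopped_process_def min_def ennreal_le_iff2)
next
  case top
  then show ?thesis using assms by (simp add: stopped_process_def)
qed

lemma stopped_process_before:
  assumes "0 \<le> t" "ennreal t \<le> \<sigma> \<omega>"
  shows "stopped_process X \<sigma> t \<omega> = X t \<omega>"
  using assms by (simp add: stopped_process_def min_absorb2)

lemma stopped_process_pos: "0 \<le> t \<Longrightarrow> \<omega> \<in> space M \<Longrightarrow> 0 < stopped_process X \<sigma> t \<omega>"
  unfolding stopped_process_def by (rule pos) auto

lemma stopped_process_cont:
  assumes \<omega>: "\<omega> \<in> space M"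
  shows "continuous_on {0..} (\<lambda>t. stopped_process X \<sigma> t \<omega>)"
proof (cases "\<sigma> \<omega> = \<top>")
  case True
  have "continuous_on {0..} (\<lambda>t. stopped_process X \<sigma> t \<omega>) \<longleftrightarrow> continuous_on {0..} (\<lambda>t. X t \<omega>)"
    by (intro continuous_on_cong) (auto simp: stopped_process_eq True)
  then show ?thesis using cont[OF \<omega>] by simp
next
  case False
  have "continuous_on {0..} (\<lambda>t. X (min (enn2real (\<sigma> \<omega>)) t) \<omega>)"
    by (rule continuous_on_compose2[OF cont[OF \<omega>]]) (auto intro!: continuous_intros)
  moreover have "continuous_on {0..} (\<lambda>t. stopped_process X \<sigma> t \<omega>) \<longleftrightarrow>
      continuous_on {0..} (\<lambda>t. X (min (enn2real (\<sigma> \<omega>)) t) \<omega>)"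
    by (intro continuous_on_cong) (auto simp: stopped_process_eq False)
  ultimately show ?thesis by simp
qed

text \<open>Pathwise form of localization: at any given time the stopping is eventually inactive, so
  the limits below are limits of eventually constant sequences.\<close>

lemma localizing_sequence:
  obtains L :: "nat \<Rightarrow> 'a \<Rightarrow> ennreal"
  where "\<And>n. stopping_time_infty F (L n)"
    and "\<And>n. martingale M F {0..} (stopped_process X (L n))"
    and "AE \<omega> in M. \<forall>s. \<forall>\<^sub>F n in sequentially. ennreal s < L n \<omega>"
proof -
  obtain L :: "nat \<Rightarrow> 'a \<Rightarrow> ennreal" where L: "\<And>n. stopping_time_infty F (L n)"
    "\<And>n. martingale M F {0..} (stopped_process X (L n))"
    "AE \<omega> in M. incseq (\<lambda>n. L n \<omega>) \<and> (\<lambda>n. L n \<omega>) \<longlonglongrightarrow> \<infinity>"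
    using local_mart unfolding local_martingale_def by auto
  have "AE \<omega> in M. \<forall>s. \<forall>\<^sub>F n in sequentially. ennreal s < L n \<omega>"
    using L(3)
  proof eventually_elim
    case (elim \<omega>)
    then have lim: "(\<lambda>n. L n \<omega>) \<longlonglongrightarrow> \<infinity>" by simp
    have "\<forall>\<^sub>F n in sequentially. ennreal s < L n \<omega>" for s
      by (rule order_tendstoD(1)[OF lim]) simp
    then show ?case by blast
  qed
  with L show thesis using that by blast
qed

lemma integrable_X0: "integrable M (X 0)"
proof -
  obtain L :: "nat \<Rightarrow> 'a \<Rightarrow> ennreal" where "martingale M F {0..} (stopped_process X (L 0))"
    using localizing_sequence by metis
  then have "integrable M (stopped_process X (L 0) 0)" by (simp add: martingale_def)
  then show ?thesis by (simp add: stopped_process_def[abs_def])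
qed

text \<open>Each stopped process is a martingale and gives the identity with both sides equal to its
  integral at \<open>T\<close>. The integrable bound \<open>V\<close> on the path up to
  \<open>\<tau>\<close> then removes the localization.\<close>

lemma optional_sampling_dominated:
  assumes \<sigma>: "stopping_time F \<sigma>" and \<tau>: "stopping_time F \<tau>"
    and bounds: "\<And>\<omega>. \<omega> \<in> space M \<Longrightarrow> 0 \<le> \<sigma> \<omega>" "\<And>\<omega>. \<omega> \<in> space M \<Longrightarrow> \<sigma> \<omega> \<le> \<tau> \<omega>"
      "\<And>\<omega>. \<omega> \<in> space M \<Longrightarrow> \<tau> \<omega> \<le> T"
    and V: "integrable M V" "\<And>\<omega> s. \<omega> \<in> space M \<Longrightarrow> 0 \<le> s \<Longrightarrow> s \<le> \<tau> \<omega> \<Longrightarrow> X s \<omega> \<le> V \<omega>"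
    and A: "A \<in> sets (pre_sigma \<sigma>)"
  shows "(\<integral>\<^sup>+\<omega>\<in>A. ennreal (X (\<sigma> \<omega>) \<omega>) \<partial>M) = (\<integral>\<^sup>+\<omega>\<in>A. ennreal (X (\<tau> \<omega>) \<omega>) \<partial>M)"
proof -
  obtain L :: "nat \<Rightarrow> 'a \<Rightarrow> ennreal"
    where mart: "\<And>n. martingale M F {0..} (stopped_process X (L n))"
    and L: "AE \<omega> in M. \<forall>s. \<forall>\<^sub>F n in sequentially. ennreal s < L n \<omega>"
    using localizing_sequence by metis
  define Y where "Y n = stopped_process X (L n)" for n
  obtain \<omega>0 where "\<omega>0 \<in> space M" using not_empty by auto
  then have "0 \<le> T" using bounds[of \<omega>0] by linarith
  have AM: "A \<in> sets M"
    using A pre_sigma_subset_sets[OF \<sigma>, of T] bounds sets_F_subset by (meson order_trans subsetD)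
  have lim: "(\<lambda>n. \<integral>\<^sup>+\<omega>\<in>A. ennreal (Y n (\<rho> \<omega>) \<omega>) \<partial>M) \<longlonglongrightarrow> (\<integral>\<^sup>+\<omega>\<in>A. ennreal (X (\<rho> \<omega>) \<omega>) \<partial>M)"
    if \<rho>: "stopping_time F \<rho>" and \<rho>_bounds: "\<And>\<omega>. \<omega> \<in> space M \<Longrightarrow> 0 \<le> \<rho> \<omega>"
      "\<And>\<omega>. \<omega> \<in> space M \<Longrightarrow> \<rho> \<omega> \<le> \<tau> \<omega>" for \<rho>
  proof -
    have stopped_meas: "(\<lambda>\<omega>. Z (\<rho> \<omega>) \<omega>) \<in> borel_measurable M"
      if "\<And>t. 0 \<le> t \<Longrightarrow> Z t \<in> borel_measurable (F t)"
        "\<And>\<omega>. \<omega> \<in> space M \<Longrightarrow> continuous_on {0..} (\<lambda>t. Z t \<omega>)" for Z :: "real \<Rightarrow> 'a \<Rightarrow> real"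
    proof -
      have "(\<lambda>\<omega>. Z (\<rho> \<omega>) \<omega>) \<in> borel_measurable (pre_sigma \<rho>)"
        using that \<rho> \<rho>_bounds by (intro borel_measurable_stopped[OF filtration_axioms]) auto
      moreover have "sets (pre_sigma \<rho>) \<subseteq> sets M"
        using pre_sigma_subset_sets[OF \<rho>, of T] \<rho>_bounds bounds sets_F_subset by (meson order_trans)
      ultimately show ?thesis
        by (intro measurable_from_subalg[of M "pre_sigma \<rho>"]) (auto simp: subalgebra_def space_pre_sigma)
    qed
    have [measurable]: "(\<lambda>\<omega>. Y n (\<rho> \<omega>) \<omega>) \<in> borel_measurable M" for n
      using mart[of n] by (intro stopped_meas) (auto simp: Y_def martingale_def stopped_process_cont)
    have [measurable]: "(\<lambda>\<omega>. X (\<rho> \<omega>) \<omega>) \<in> borel_measurable M"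
      by (intro stopped_meas adapted cont)
    have [measurable]: "V \<in> borel_measurable M" "A \<in> sets M"
      using V AM by auto
    show ?thesis
    proof (rule nn_integral_dominated_convergence[where w = "\<lambda>\<omega>. ennreal (V \<omega>)"])
      show "AE \<omega> in M. ennreal (Y n (\<rho> \<omega>) \<omega>) * indicator A \<omega> \<le> ennreal (V \<omega>)" for n
      proof (rule AE_I2)
        fix \<omega> assume \<omega>: "\<omega> \<in> space M"
        \<comment> \<open>The stopped process at \<open>\<rho>\<close> is \<open>X\<close> at the
          earlier time \<open>s\<close>, which still lies before \<open>\<tau>\<close>, so
          \<open>V\<close> dominates uniformly in \<open>n\<close>.\<close>
        define s where "s = enn2real (min (L n \<omega>) (ennreal (\<rho> \<omega>)))"
        have "s \<le> \<rho> \<omega>"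
          unfolding s_def using \<rho>_bounds(1)[OF \<omega>] by (intro enn2real_leI) auto
        then have "X s \<omega> \<le> V \<omega>"
          using V(2)[OF \<omega>, of s] \<rho>_bounds(2)[OF \<omega>] by (auto simp: s_def)
        then show "ennreal (Y n (\<rho> \<omega>) \<omega>) * indicator A \<omega> \<le> ennreal (V \<omega>)"
          by (auto simp: Y_def stopped_process_def s_def split: split_indicator intro: ennreal_leI)
      qed
      have V_nonneg: "0 \<le> V \<omega>" if "\<omega> \<in> space M" for \<omega>
        using V(2)[OF that, of 0] pos[OF _ that, of 0] bounds[OF that] by linarith
      have "(\<integral>\<^sup>+\<omega>. ennreal (V \<omega>) \<partial>M) = ennreal (\<integral>\<omega>. V \<omega> \<partial>M)"
        using V V_nonneg by (intro nn_integral_eq_integral) auto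
      then show "(\<integral>\<^sup>+\<omega>. ennreal (V \<omega>) \<partial>M) < \<infinity>" by simp
      show "AE \<omega> in M. (\<lambda>n. ennreal (Y n (\<rho> \<omega>) \<omega>) * indicator A \<omega>) \<longlonglongrightarrow>
          ennreal (X (\<rho> \<omega>) \<omega>) * indicator A \<omega>"
        using L AE_space
      proof eventually_elim
        case (elim \<omega>)
        then have "\<forall>\<^sub>F n in sequentially. ennreal (\<rho> \<omega>) < L n \<omega>" by blast
        then have "\<forall>\<^sub>F n in sequentially. ennreal (Y n (\<rho> \<omega>) \<omega>) * indicator A \<omega> =
            ennreal (X (\<rho> \<omega>) \<omega>) * indicator A \<omega>"
          by eventually_elim (use \<rho>_bounds(1) elim in \<open>simp add: Y_def stopped_process_before\<close>)
        then show ?case by (rule tendsto_eventually)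
      qed
    qed measurable
  qed
  have sampling: "(\<integral>\<^sup>+\<omega>\<in>A. ennreal (Y n (\<rho> \<omega>) \<omega>) \<partial>M) = (\<integral>\<^sup>+\<omega>\<in>A. ennreal (Y n T \<omega>) \<partial>M)"
    if "stopping_time F \<rho>" "\<And>\<omega>. \<omega> \<in> space M \<Longrightarrow> 0 \<le> \<rho> \<omega>"
      "\<And>\<omega>. \<omega> \<in> space M \<Longrightarrow> \<rho> \<omega> \<le> \<tau> \<omega>" "A \<in> sets (pre_sigma \<rho>)" for \<rho> n
    unfolding Y_def
    using that bounds(3) \<open>0 \<le> T\<close> order_trans[OF that(3) bounds(3)]
    by (intro optional_sampling_continuous[OF mart])
      (auto intro: less_imp_le[OF stopped_process_pos] stopped_process_cont)
  have \<tau>_nonneg: "\<omega> \<in> space M \<Longrightarrow> 0 \<le> \<tau> \<omega>" for \<omega>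
    using bounds(1,2) order_trans by blast
  have "A \<in> sets (pre_sigma \<tau>)"
    using A mono_pre_sigma[OF \<sigma> \<tau> bounds(2)] by blast
  then have "(\<integral>\<^sup>+\<omega>\<in>A. ennreal (Y n (\<sigma> \<omega>) \<omega>) \<partial>M) = (\<integral>\<^sup>+\<omega>\<in>A. ennreal (Y n (\<tau> \<omega>) \<omega>) \<partial>M)" for n
    using sampling[OF \<sigma> bounds(1,2) A, of n] sampling[OF \<tau> \<tau>_nonneg order_refl, of n] by simp
  moreover have "(\<lambda>n. \<integral>\<^sup>+\<omega>\<in>A. ennreal (Y n (\<sigma> \<omega>) \<omega>) \<partial>M) \<longlonglongrightarrow> (\<integral>\<^sup>+\<omega>\<in>A. ennreal (X (\<sigma> \<omega>) \<omega>) \<partial>M)"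
    by (rule lim[OF \<sigma> bounds(1,2)])
  moreover have "(\<lambda>n. \<integral>\<^sup>+\<omega>\<in>A. ennreal (Y n (\<tau> \<omega>) \<omega>) \<partial>M) \<longlonglongrightarrow> (\<integral>\<^sup>+\<omega>\<in>A. ennreal (X (\<tau> \<omega>) \<omega>) \<partial>M)"
    by (rule lim[OF \<tau> \<tau>_nonneg order_refl])
  ultimately show ?thesis
    by (simp add: LIMSEQ_unique)
qed

text \<open>Fatou along the localizing sequence. It is used to see that the failure of the
  martingale property is a loss of expectation.\<close>

lemma supermartingale:
  assumes st: "0 \<le> s" "s \<le> t" and A: "A \<in> sets (F s)"
  shows "(\<integral>\<^sup>+\<omega>\<in>A. ennreal (X t \<omega>) \<partial>M) \<le> (\<integral>\<^sup>+\<omega>\<in>A. ennreal (X s \<omega>) \<partial>M)"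
proof -
  obtain L :: "nat \<Rightarrow> 'a \<Rightarrow> ennreal"
    where stop: "\<And>n. stopping_time_infty F (L n)"
    and mart: "\<And>n. martingale M F {0..} (stopped_process X (L n))"
    and L: "AE \<omega> in M. \<forall>s. \<forall>\<^sub>F n in sequentially. ennreal s < L n \<omega>"
    using localizing_sequence by metis
  define Y where "Y n = stopped_process X (L n)" for n
  \<comment> \<open>On all of \<open>A\<close> the values \<open>Y n s\<close> have no common bound.
    On the smaller event \<open>C n\<close>, which is known at time \<open>s\<close>, they equal
    \<open>X s\<close>, while \<open>C n\<close> still fills \<open>A\<close> in the limit almost
    surely.\<close>
  define C where "C n = {\<omega>\<in>A. ennreal s < L n \<omega>}" for n
  have "0 \<le> t" using st by simp
  have [measurable]: "Y n t \<in> borel_measurable M" for n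
    using mart[of n] \<open>0 \<le> t\<close> by (auto simp: Y_def martingale_def)
  have C: "C n \<in> sets (F s)" for n
  proof -
    have "{\<omega>\<in>space (F s). L n \<omega> \<le> ennreal s} \<in> sets (F s)"
      using stop[of n] st by (simp add: stopping_time_infty_def pred_def)
    then have "A - {\<omega>\<in>space (F s). L n \<omega> \<le> ennreal s} \<in> sets (F s)"
      using A by auto
    also have "A - {\<omega>\<in>space (F s). L n \<omega> \<le> ennreal s} = C n"
      using sets.sets_into_space[OF A] by (auto simp: C_def)
    finally show ?thesis .
  qed
  have [measurable]: "C n \<in> sets M" for n
    using C sets_F_subset by blast
  have "(\<integral>\<^sup>+\<omega>\<in>A. ennreal (X t \<omega>) \<partial>M) = (\<integral>\<^sup>+\<omega>. liminf (\<lambda>n. ennreal (Y n t \<omega>) * indicator (C n) \<omega>) \<partial>M)"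
  proof (rule nn_integral_cong_AE)
    show "AE \<omega> in M. ennreal (X t \<omega>) * indicator A \<omega> = liminf (\<lambda>n. ennreal (Y n t \<omega>) * indicator (C n) \<omega>)"
      using L
    proof eventually_elim
      case (elim \<omega>)
      then have "\<forall>\<^sub>F n in sequentially. ennreal t < L n \<omega>" "\<forall>\<^sub>F n in sequentially. ennreal s < L n \<omega>"
        by auto
      then have "\<forall>\<^sub>F n in sequentially. ennreal (Y n t \<omega>) * indicator (C n) \<omega> = ennreal (X t \<omega>) * indicator A \<omega>"
        by eventually_elim
          (use \<open>0 \<le> t\<close> in \<open>auto simp: Y_def stopped_process_before C_def split: split_indicator\<close>)
      then have "(\<lambda>n. ennreal (Y n t \<omega>) * indicator (C n) \<omega>) \<longlonglongrightarrow> ennreal (X t \<omega>) * indicator A \<omega>"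
        by (rule tendsto_eventually)
      then show ?case by (simp add: lim_imp_Liminf)
    qed
  qed
  also have "\<dots> \<le> liminf (\<lambda>n. \<integral>\<^sup>+\<omega>\<in>C n. ennreal (Y n t \<omega>) \<partial>M)"
    by (intro nn_integral_liminf) measurable
  also have "(\<lambda>n. \<integral>\<^sup>+\<omega>\<in>C n. ennreal (Y n t \<omega>) \<partial>M) = (\<lambda>n. \<integral>\<^sup>+\<omega>\<in>C n. ennreal (Y n s \<omega>) \<partial>M)"
    unfolding Y_def using st C
    by (intro ext martingale_set_nn_integral[OF mart, symmetric])
      (auto intro: less_imp_le[OF stopped_process_pos])
  also have "liminf (\<lambda>n. \<integral>\<^sup>+\<omega>\<in>C n. ennreal (Y n s \<omega>) \<partial>M) \<le> liminf (\<lambda>n. \<integral>\<^sup>+\<omega>\<in>A. ennreal (X s \<omega>) \<partial>M)"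
  proof (intro Liminf_mono always_eventually allI nn_integral_mono)
    fix n \<omega>
    show "ennreal (Y n s \<omega>) * indicator (C n) \<omega> \<le> ennreal (X s \<omega>) * indicator A \<omega>"
      using st by (auto simp: C_def Y_def stopped_process_before split: split_indicator)
  qed
  also have "\<dots> = (\<integral>\<^sup>+\<omega>\<in>A. ennreal (X s \<omega>) \<partial>M)"
    by (simp add: Liminf_const)
  finally show ?thesis .
qed

lemma expectation_decreasing:
  assumes "0 \<le> s" "s \<le> t"
  shows "(\<integral>\<^sup>+\<omega>. ennreal (X t \<omega>) \<partial>M) \<le> (\<integral>\<^sup>+\<omega>. ennreal (X s \<omega>) \<partial>M)"
proof -
  have "(\<integral>\<^sup>+\<omega>. f \<omega> \<partial>M) = (\<integral>\<^sup>+\<omega>\<in>space M. f \<omega> \<partial>M)" for f :: "'a \<Rightarrow> ennreal"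
    by (intro nn_integral_cong) simp
  then show ?thesis
    using supermartingale[OF assms, of "space M"] sets.top[of "F s"] by (simp add: space_F)
qed

lemma expectation_finite:
  assumes "0 \<le> t"
  shows "(\<integral>\<^sup>+\<omega>. ennreal (X t \<omega>) \<partial>M) < \<infinity>"
proof -
  have "(\<integral>\<^sup>+\<omega>. ennreal (X 0 \<omega>) \<partial>M) = ennreal (\<integral>\<omega>. X 0 \<omega> \<partial>M)"
    using integrable_X0 pos[of 0] by (intro nn_integral_eq_integral) (auto intro: less_imp_le)
  then show ?thesis using expectation_decreasing[of 0 t] assms by (simp add: le_less_trans)
qed

lemma integrable_X: "0 \<le> t \<Longrightarrow> integrable M (X t)"
  using expectation_finite[of t] measurable_X[of t] pos[of t]
  by (auto intro!: integrableI_nonneg AE_I2 less_imp_le)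

text \<open>The supermartingale inequality holds on an event and on its complement. If the sum loses
  nothing, neither part does. By contraposition, a strict local martingale has some \<open>t\<close>
  with smaller expectation than at time 0.\<close>

lemma martingaleI_expectation:
  assumes const: "\<And>t. 0 \<le> t \<Longrightarrow> (\<integral>\<^sup>+\<omega>. ennreal (X 0 \<omega>) \<partial>M) \<le> (\<integral>\<^sup>+\<omega>. ennreal (X t \<omega>) \<partial>M)"
  shows "martingale M F {0..} X"
proof (rule martingaleI_set_nn_integral)
  show "filtered_prob_space M F" by (rule filtered_prob_space_axioms)
  fix s t :: real and A assume "s \<in> {0..}" "t \<in> {0..}" "s \<le> t" and A: "A \<in> sets (F s)"
  then have st: "0 \<le> s" "0 \<le> t" by auto
  have [measurable]: "A \<in> sets M" "X s \<in> borel_measurable M" "X t \<in> borel_measurable M"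
    using A sets_F_subset st by (auto intro: measurable_X)
  have sum_parts: "(\<integral>\<^sup>+\<omega>. f \<omega> \<partial>M) = (\<integral>\<^sup>+\<omega>\<in>A. f \<omega> \<partial>M) + (\<integral>\<^sup>+\<omega>\<in>space M - A. f \<omega> \<partial>M)"
    if [measurable]: "f \<in> borel_measurable M" for f :: "'a \<Rightarrow> ennreal"
  proof -
    have "(\<integral>\<^sup>+\<omega>. f \<omega> \<partial>M) = (\<integral>\<^sup>+\<omega>. f \<omega> * indicator A \<omega> + f \<omega> * indicator (space M - A) \<omega> \<partial>M)"
      by (intro nn_integral_cong) (auto split: split_indicator)
    then show ?thesis by (simp add: nn_integral_add)
  qed
  have le: "(\<integral>\<^sup>+\<omega>\<in>A. ennreal (X t \<omega>) \<partial>M) \<le> (\<integral>\<^sup>+\<omega>\<in>A. ennreal (X s \<omega>) \<partial>M)"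
    "(\<integral>\<^sup>+\<omega>\<in>space M - A. ennreal (X t \<omega>) \<partial>M) \<le> (\<integral>\<^sup>+\<omega>\<in>space M - A. ennreal (X s \<omega>) \<partial>M)"
    using supermartingale[OF st(1) \<open>s \<le> t\<close>] A sets.compl_sets[OF A] by (auto simp: space_F)
  have "(\<integral>\<^sup>+\<omega>. ennreal (X s \<omega>) \<partial>M) \<le> (\<integral>\<^sup>+\<omega>. ennreal (X t \<omega>) \<partial>M)"
    using expectation_decreasing[of 0 s] const[of t] st by (meson order_refl order_trans)
  then have sum: "(\<integral>\<^sup>+\<omega>\<in>A. ennreal (X s \<omega>) \<partial>M) + (\<integral>\<^sup>+\<omega>\<in>space M - A. ennreal (X s \<omega>) \<partial>M) \<le>
      (\<integral>\<^sup>+\<omega>\<in>A. ennreal (X t \<omega>) \<partial>M) + (\<integral>\<^sup>+\<omega>\<in>space M - A. ennreal (X t \<omega>) \<partial>M)"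
    using sum_parts[of "\<lambda>\<omega>. ennreal (X s \<omega>)"] sum_parts[of "\<lambda>\<omega>. ennreal (X t \<omega>)"] by simp
  have fin: "(\<integral>\<^sup>+\<omega>\<in>B. ennreal (X s \<omega>) \<partial>M) < \<infinity>" for B
    using expectation_finite[OF st(1)]
    by (rule le_less_trans[rotated]) (auto intro!: nn_integral_mono split: split_indicator)
  show "(\<integral>\<^sup>+\<omega>\<in>A. ennreal (X s \<omega>) \<partial>M) = (\<integral>\<^sup>+\<omega>\<in>A. ennreal (X t \<omega>) \<partial>M)"
  proof (rule antisym[OF _ le(1)])
    \<comment> \<open>Both sides now carry the same finite term over the complement, which is
      cancelled.\<close>
    have "(\<integral>\<^sup>+\<omega>\<in>A. ennreal (X s \<omega>) \<partial>M) + (\<integral>\<^sup>+\<omega>\<in>space M - A. ennreal (X s \<omega>) \<partial>M) \<le>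
      (\<integral>\<^sup>+\<omega>\<in>A. ennreal (X t \<omega>) \<partial>M) + (\<integral>\<^sup>+\<omega>\<in>space M - A. ennreal (X s \<omega>) \<partial>M)"
      using sum le(2) by (meson add_left_mono order_trans)
    then show "(\<integral>\<^sup>+\<omega>\<in>A. ennreal (X s \<omega>) \<partial>M) \<le> (\<integral>\<^sup>+\<omega>\<in>A. ennreal (X t \<omega>) \<partial>M)"
      using fin[of "space M - A"]
      by (simp only: add.commute[of _ "\<integral>\<^sup>+\<omega>\<in>space M - A. ennreal (X s \<omega>) \<partial>M"]
          ennreal_add_left_cancel_le) auto
  qed
qed (auto intro: adapted integrable_X less_imp_le[OF pos])

end

subsection \<open>Truncated hitting times and the sampled martingale\<close>

definition truncated_hit :: "(real \<Rightarrow> 'a \<Rightarrow> real) \<Rightarrow> real \<Rightarrow> real \<Rightarrow> 'a \<Rightarrow> real" where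
  "truncated_hit X c T \<omega> = enn2real (min (hitting_time X c \<omega>) (ennreal T))"

lemma tau_ab_eq: "tau_ab X a b n = (if n = 0 then (\<lambda>_. 0) else truncated_hit X (b n) (a n))"
  by (auto simp: tau_ab_def truncated_hit_def)

context positive_continuous_local_martingale
begin

text \<open>A continuous path attains the infimum: if it is below \<open>c\<close> on all of [0, t],
  it stays below \<open>c\<close> a little longer, and the hitting time exceeds
  \<open>t\<close>.\<close>

lemma hitting_time_le_iff:
  assumes \<omega>: "\<omega> \<in> space M" and t: "0 \<le> t"
  shows "hitting_time X c \<omega> \<le> ennreal t \<longleftrightarrow> (\<exists>s\<in>{0..t}. c \<le> X s \<omega>)"
proof
  assume "\<exists>s\<in>{0..t}. c \<le> X s \<omega>"
  then obtain s where "0 \<le> s" "s \<le> t" "c \<le> X s \<omega>" by auto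
  then have "hitting_time X c \<omega> \<le> ennreal s"
    unfolding hitting_time_def by (intro Inf_lower) auto
  also have "\<dots> \<le> ennreal t" using \<open>s \<le> t\<close> by (rule ennreal_leI)
  finally show "hitting_time X c \<omega> \<le> ennreal t" .
next
  assume le: "hitting_time X c \<omega> \<le> ennreal t"
  show "\<exists>s\<in>{0..t}. c \<le> X s \<omega>"
  proof (rule ccontr)
    assume "\<not> (\<exists>s\<in>{0..t}. c \<le> X s \<omega>)"
    then have below: "X s \<omega> < c" if "0 \<le> s" "s \<le> t" for s
      using that by force
    obtain d where d: "d > 0" "\<And>s. 0 \<le> s \<Longrightarrow> dist s t < d \<Longrightarrow> dist (X s \<omega>) (X t \<omega>) < c - X t \<omega>"
      using cont[OF \<omega>] t below[of t] unfolding continuous_on_iff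
      by (metis atLeast_iff diff_gt_0_iff_gt order_refl)
    have "ennreal (t + d) \<le> hitting_time X c \<omega>"
      unfolding hitting_time_def
    proof (rule Inf_greatest, clarify)
      fix s assume s: "0 \<le> s" "c \<le> X s \<omega>"
      have "\<not> dist s t < d" using d(2)[OF s(1)] s(2) by (auto simp: dist_real_def)
      moreover have "t < s" using below[OF s(1)] s(2) by force
      ultimately show "ennreal (t + d) \<le> ennreal s"
        by (intro ennreal_leI) (auto simp: dist_real_def)
    qed
    also note le
    finally show False using t d(1) by (simp add: ennreal_le_iff2)
  qed
qed

text \<open>Compactness turns reaching \<open>c\<close> into coming within every
  \<open>1 / (n + 1)\<close> of it. The strict inequality describes an open set of times, so a
  countable dense set detects it.\<close>

lemma measurable_hit:
  assumes "0 \<le> t"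
  shows "Measurable.pred (F t) (\<lambda>\<omega>. \<exists>s\<in>{0..t}. c \<le> X s \<omega>)"
proof -
  obtain D :: "real set" where D: "countable D" "\<And>U. open U \<Longrightarrow> U \<noteq> {} \<Longrightarrow> \<exists>d\<in>D. d \<in> U"
    using countable_dense_setE by auto
  \<comment> \<open>The map from \<open>q\<close> to \<open>min t \<bar>q\<bar>\<close> folds the
    real line onto [0, t], so one dense subset of the line serves for every
    \<open>t\<close>.\<close>
  have iff: "(\<exists>s\<in>{0..t}. c \<le> X s \<omega>) \<longleftrightarrow> (\<forall>n. \<exists>q\<in>D. c - 1 / real (Suc n) < X (min t \<bar>q\<bar>) \<omega>)"
    if \<omega>: "\<omega> \<in> space (F t)" for \<omega>
  proof
    have \<omega>: "\<omega> \<in> space M" using \<omega> by (simp add: space_F)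
    assume "\<exists>s\<in>{0..t}. c \<le> X s \<omega>"
    then obtain s where s: "0 \<le> s" "s \<le> t" "c \<le> X s \<omega>" by auto
    have cont': "continuous_on UNIV (\<lambda>q. X (min t \<bar>q\<bar>) \<omega>)"
      by (rule continuous_on_compose2[OF cont[OF \<omega>]]) (use assms in \<open>auto intro!: continuous_intros\<close>)
    show "\<forall>n. \<exists>q\<in>D. c - 1 / real (Suc n) < X (min t \<bar>q\<bar>) \<omega>"
    proof
      fix n
      let ?U = "{q. c - 1 / real (Suc n) < X (min t \<bar>q\<bar>) \<omega>}"
      have "open ?U"
        by (intro open_Collect_less continuous_intros cont')
      moreover have "c - 1 / real (Suc n) < X s \<omega>"
        by (rule less_le_trans[OF _ s(3)]) simp
      then have "s \<in> ?U" using s by (simp add: min_def)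
      ultimately show "\<exists>q\<in>D. c - 1 / real (Suc n) < X (min t \<bar>q\<bar>) \<omega>"
        using D(2)[of ?U] by blast
    qed
  next
    have \<omega>: "\<omega> \<in> space M" using \<omega> by (simp add: space_F)
    assume R: "\<forall>n. \<exists>q\<in>D. c - 1 / real (Suc n) < X (min t \<bar>q\<bar>) \<omega>"
    have "continuous_on {0..t} (\<lambda>s. X s \<omega>)"
      using cont[OF \<omega>] by (rule continuous_on_subset) auto
    then obtain s where s: "s \<in> {0..t}" "\<And>u. u \<in> {0..t} \<Longrightarrow> X u \<omega> \<le> X s \<omega>"
      using continuous_attains_sup[of "{0..t}" "\<lambda>s. X s \<omega>"] assms by auto
    have "c - 1 / real (Suc n) \<le> X s \<omega>" for n
    proof -
      obtain q where "c - 1 / real (Suc n) < X (min t \<bar>q\<bar>) \<omega>" using R by blast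
      also have "\<dots> \<le> X s \<omega>" using assms by (intro s(2)) auto
      finally show ?thesis by simp
    qed
    moreover have "(\<lambda>n. c - 1 / real (Suc n)) \<longlonglongrightarrow> c"
      using tendsto_diff[OF tendsto_const LIMSEQ_inverse_real_of_nat, of c]
      by (simp add: inverse_eq_divide)
    ultimately have "c \<le> X s \<omega>"
      by (intro LIMSEQ_le_const2) auto
    then show "\<exists>s\<in>{0..t}. c \<le> X s \<omega>" using s(1) by blast
  qed
  have "Measurable.pred (F t) (\<lambda>\<omega>. \<forall>n. \<exists>q\<in>D. c - 1 / real (Suc n) < X (min t \<bar>q\<bar>) \<omega>)"
  proof (intro pred_intros_countable(1) measurable_pred_countable(2) D(1))
    fix n q
    have [measurable]: "X (min t \<bar>q\<bar>) \<in> borel_measurable (F t)"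
      using assms by (intro measurable_F_mono[OF adapted]) auto
    show "Measurable.pred (F t) (\<lambda>\<omega>. c - 1 / real (Suc n) < X (min t \<bar>q\<bar>) \<omega>)"
      by measurable
  qed
  then show ?thesis
    by (rule measurable_cong[THEN iffD2, rotated]) (rule iff)
qed

lemma truncated_hit_nonneg: "0 \<le> truncated_hit X c T \<omega>"
  by (simp add: truncated_hit_def)

lemma truncated_hit_le: "0 \<le> T \<Longrightarrow> truncated_hit X c T \<omega> \<le> T"
  unfolding truncated_hit_def by (intro enn2real_leI) auto

lemma truncated_hit_le_iff:
  assumes "\<omega> \<in> space M" "0 \<le> t" "0 \<le> T"
  shows "truncated_hit X c T \<omega> \<le> t \<longleftrightarrow> T \<le> t \<or> (\<exists>s\<in>{0..t}. c \<le> X s \<omega>)"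
proof -
  have "enn2real x \<le> t \<longleftrightarrow> x \<le> ennreal t" if "x < \<top>" for x
    using that assms(2) by (cases x) (auto simp: ennreal_le_iff)
  from this[of "min (hitting_time X c \<omega>) (ennreal T)"]
  have "truncated_hit X c T \<omega> \<le> t \<longleftrightarrow> ennreal T \<le> ennreal t \<or> hitting_time X c \<omega> \<le> ennreal t"
    by (auto simp: truncated_hit_def min_le_iff_disj min_less_iff_disj)
  then show ?thesis
    using hitting_time_le_iff[OF assms(1,2)] assms by (simp add: ennreal_le_iff)
qed

lemma stopping_time_truncated_hit:
  assumes "0 \<le> T"
  shows "stopping_time F (truncated_hit X c T)"
proof
  fix t
  show "Measurable.pred (F t) (\<lambda>\<omega>. truncated_hit X c T \<omega> \<le> t)"
  proof (cases "0 \<le> t")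
    case True
    then have "Measurable.pred (F t) (\<lambda>\<omega>. truncated_hit X c T \<omega> \<le> t) \<longleftrightarrow>
        Measurable.pred (F t) (\<lambda>\<omega>. T \<le> t \<or> (\<exists>s\<in>{0..t}. c \<le> X s \<omega>))"
      using assms by (intro measurable_cong) (simp add: truncated_hit_le_iff space_F)
    then show ?thesis using measurable_hit[OF True] by auto
  next
    case False
    then have "\<not> truncated_hit X c T \<omega> \<le> t" for \<omega>
      using truncated_hit_nonneg[of c T \<omega>] by linarith
    then show ?thesis by simp
  qed
qed

lemma before_truncated_hit:
  assumes "\<omega> \<in> space M" "0 \<le> T" "0 \<le> s" "s < truncated_hit X c T \<omega>"
  shows "X s \<omega> < c"
proof -
  have "\<not> (\<exists>u\<in>{0..s}. c \<le> X u \<omega>)"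
    using truncated_hit_le_iff[OF assms(1,3,2), of c] assms(4) by auto
  then show ?thesis using assms(3) by force
qed

text \<open>The maximum covers a path that starts above \<open>c\<close>: its hitting time is 0.
  Otherwise the bound at the hitting time is the limit of the strict bound from the left.\<close>

lemma upto_truncated_hit:
  assumes \<omega>: "\<omega> \<in> space M" and "0 \<le> T" "0 \<le> s" "s \<le> truncated_hit X c T \<omega>"
  shows "X s \<omega> \<le> max c (X 0 \<omega>)"
proof (cases "s < truncated_hit X c T \<omega>")
  case True
  then show ?thesis using before_truncated_hit[OF assms(1-3)] by force
next
  case False
  then have s: "s = truncated_hit X c T \<omega>" using assms by simp
  show ?thesis
  proof (cases "s = 0")
    case False
    then have "0 < s" using assms by simp
    have "(\<lambda>n. s - s / real (Suc n)) \<longlonglongrightarrow> s"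
      using tendsto_diff[OF tendsto_const tendsto_mult[OF tendsto_const LIMSEQ_inverse_real_of_nat], of s s]
      by (simp add: divide_inverse)
    moreover have nonneg: "0 \<le> s - s / real (Suc n)" for n
      using \<open>0 < s\<close> by (simp add: field_simps)
    ultimately have "(\<lambda>n. X (s - s / real (Suc n)) \<omega>) \<longlonglongrightarrow> X s \<omega>"
      using \<open>0 < s\<close> by (intro continuous_on_tendsto_compose[OF cont[OF \<omega>]]) auto
    moreover have "X (s - s / real (Suc n)) \<omega> \<le> c" for n
      by (rule less_imp_le[OF before_truncated_hit[OF \<omega> assms(2) nonneg]])
        (use \<open>0 < s\<close> in \<open>simp add: s[symmetric] del: of_nat_Suc\<close>)
    ultimately have "X s \<omega> \<le> c"
      by (intro LIMSEQ_le_const2) auto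
    then show ?thesis by simp
  qed simp
qed

lemma truncated_hit_no_hit:
  assumes "\<omega> \<in> space M" "0 \<le> T" "\<not> (\<exists>s\<in>{0..T}. c \<le> X s \<omega>)"
  shows "truncated_hit X c T \<omega> = T"
proof (rule antisym[OF truncated_hit_le[OF assms(2)]])
  show "T \<le> truncated_hit X c T \<omega>"
    using truncated_hit_le_iff[OF assms(1) truncated_hit_nonneg assms(2), of c c T \<omega>] assms(3)
      truncated_hit_le[OF assms(2), of c \<omega>] by force
qed

text \<open>The path stops at exactly \<open>c\<close>, or at its initial value if that is larger.
  For fixed \<open>\<omega>\<close> the result is nondecreasing in \<open>c\<close> and independent
  of \<open>T\<close>, which is why samples do not drop while levels are reached.\<close>

lemma value_at_truncated_hit:
  assumes \<omega>: "\<omega> \<in> space M" and T: "0 \<le> T" and hit: "\<exists>s\<in>{0..T}. c \<le> X s \<omega>"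
  shows "X (truncated_hit X c T \<omega>) \<omega> = max c (X 0 \<omega>)"
proof -
  let ?h = "truncated_hit X c T \<omega>"
  have "\<exists>s\<in>{0..?h}. c \<le> X s \<omega>"
    using truncated_hit_le_iff[OF \<omega> truncated_hit_nonneg T, of c c T \<omega>] hit
      truncated_hit_le[OF T, of c \<omega>] by (cases "?h = T") auto
  then obtain s where s: "0 \<le> s" "s \<le> ?h" "c \<le> X s \<omega>" by auto
  have "s = ?h" using before_truncated_hit[OF \<omega> T s(1), of c] s by force
  then have "c \<le> X ?h \<omega>" using s by simp
  moreover have "X 0 \<omega> \<le> X ?h \<omega>"
  proof (cases "?h = 0")
    case False
    then have "X 0 \<omega> < c"
      using truncated_hit_nonneg[of c T \<omega>] by (intro before_truncated_hit[OF \<omega> T order_refl]) auto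
    then show ?thesis using \<open>c \<le> X ?h \<omega>\<close> by simp
  qed simp
  moreover have "X ?h \<omega> \<le> max c (X 0 \<omega>)"
    by (rule upto_truncated_hit[OF \<omega> T truncated_hit_nonneg order_refl])
  ultimately show ?thesis by simp
qed

lemma truncated_hit_mono:
  assumes "\<omega> \<in> space M" "0 \<le> T" "T \<le> T'" "c \<le> c'"
  shows "truncated_hit X c T \<omega> \<le> truncated_hit X c' T' \<omega>"
proof -
  let ?h = "truncated_hit X c' T' \<omega>"
  have "0 \<le> T'" using assms by simp
  then have "T' \<le> ?h \<or> (\<exists>s\<in>{0..?h}. c' \<le> X s \<omega>)"
    using truncated_hit_le_iff[OF assms(1) truncated_hit_nonneg, of T' c' c' T' \<omega>] by simp
  then have "T \<le> ?h \<or> (\<exists>s\<in>{0..?h}. c \<le> X s \<omega>)"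
    using assms by force
  then show ?thesis
    using truncated_hit_le_iff[OF assms(1) truncated_hit_nonneg assms(2)] by simp
qed

lemma integrable_bound: "integrable M (\<lambda>\<omega>. \<bar>c\<bar> + X 0 \<omega>)"
  using integrable_X0 by simp

lemma upto_truncated_hit_bound:
  assumes "\<omega> \<in> space M" "0 \<le> T" "0 \<le> s" "s \<le> truncated_hit X c T \<omega>"
  shows "X s \<omega> \<le> \<bar>c\<bar> + X 0 \<omega>"
  using upto_truncated_hit[OF assms] pos[of 0, OF _ assms(1)] by (auto simp: max_def split: if_splits)

end

locale sampled_positive_continuous_local_martingale = positive_continuous_local_martingale M F X
  for M :: "'a measure" and F and X +
  fixes a b :: "nat \<Rightarrow> real"
  assumes a: "increasing_to_infinity a" and b: "increasing_to_infinity b"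
begin

lemma a_pos: "1 \<le> n \<Longrightarrow> 0 < a n"
  and a_mono: "1 \<le> m \<Longrightarrow> m \<le> n \<Longrightarrow> a m \<le> a n" and b_mono: "1 \<le> m \<Longrightarrow> m \<le> n \<Longrightarrow> b m \<le> b n"
  using a b by (auto simp: increasing_to_infinity_def mono_on_def)

abbreviation "\<tau> \<equiv> tau_ab X a b"
abbreviation "S \<equiv> S_ab X a b"
abbreviation "G \<equiv> F_ab M F X a b"

lemma tau_0: "\<tau> 0 \<omega> = 0"
  by (simp add: tau_ab_def)

lemma tau_Suc: "1 \<le> n \<Longrightarrow> \<tau> n = truncated_hit X (b n) (a n)"
  by (simp add: tau_ab_eq)

lemma stopping_time_tau: "stopping_time F (\<tau> n)"
proof (cases n)
  case 0
  show ?thesis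
  proof
    fix t show "Measurable.pred (F t) (\<lambda>\<omega>. \<tau> n \<omega> \<le> t)" by (simp add: 0 tau_0)
  qed
next
  case (Suc m)
  then show ?thesis using a_pos[of n] stopping_time_truncated_hit[of "a n" "b n"] by (simp add: tau_Suc)
qed

lemma tau_nonneg: "0 \<le> \<tau> n \<omega>"
  by (simp add: tau_ab_def)

lemma tau_mono:
  assumes "\<omega> \<in> space M" "m \<le> n"
  shows "\<tau> m \<omega> \<le> \<tau> n \<omega>"
proof (cases m)
  case 0
  then show ?thesis by (simp add: tau_0 tau_nonneg)
next
  case (Suc k)
  then show ?thesis
    using assms a_pos[of m] a_mono[of m n] b_mono[of m n]
    by (simp add: tau_Suc truncated_hit_mono less_imp_le)
qed

text \<open>The maximum handles \<open>n = 0\<close>, where the sampled time is 0 and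
  \<open>a 0\<close> is arbitrary.\<close>

lemma tau_bounded: "\<tau> n \<omega> \<le> max 0 (a n)"
  using truncated_hit_le[of "a n" "b n" \<omega>] a_pos[of n] by (cases "n = 0") (auto simp: tau_ab_eq)

lemma S_bound:
  assumes "\<omega> \<in> space M" "0 \<le> s" "s \<le> \<tau> n \<omega>"
  shows "X s \<omega> \<le> \<bar>b n\<bar> + X 0 \<omega>"
proof (cases "n = 0")
  case True
  then show ?thesis using assms by (simp add: tau_0)
next
  case False
  then show ?thesis
    using assms a_pos[of n] upto_truncated_hit_bound[of \<omega> "a n" s "b n"] by (simp add: tau_Suc)
qed

lemma S_pos: "\<omega> \<in> space M \<Longrightarrow> 0 < S n \<omega>"
  unfolding S_ab_def by (rule pos[OF tau_nonneg])

lemma sets_G_subset: "sets (G n) \<subseteq> sets M"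
  unfolding F_ab_def
  using pre_sigma_subset_sets[OF stopping_time_tau tau_bounded] sets_F_subset by blast

lemma filtered_G: "filtered_prob_space M G"
proof (intro filtered_prob_space.intro filtered_prob_space_axioms.intro prob_space_axioms sets_G_subset filtration.intro)
  show "space (G i) = space M" for i by (simp add: F_ab_def space_pre_sigma)
  show "sets (G i) \<subseteq> sets (G j)" if "i \<le> j" for i j
    unfolding F_ab_def using that by (intro mono_pre_sigma stopping_time_tau tau_mono)
qed

lemma S_adapted: "S n \<in> borel_measurable (G n)"
  unfolding F_ab_def S_ab_def[abs_def]
  by (rule borel_measurable_stopped[OF filtration_axioms adapted cont stopping_time_tau tau_nonneg])

lemma measurable_S[measurable]: "S n \<in> borel_measurable M"
  by (rule filtered_prob_space.measurable_F_imp_M[OF filtered_G S_adapted])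

lemma integrable_S: "integrable M (S n)"
proof (rule Bochner_Integration.integrable_bound[OF integrable_bound[of "b n"]])
  show "AE \<omega> in M. norm (S n \<omega>) \<le> norm (\<bar>b n\<bar> + X 0 \<omega>)"
  proof (rule AE_I2)
    fix \<omega> assume "\<omega> \<in> space M"
    then show "norm (S n \<omega>) \<le> norm (\<bar>b n\<bar> + X 0 \<omega>)"
      using S_bound[of \<omega> "\<tau> n \<omega>" n] tau_nonneg S_pos[of \<omega> n] by (auto simp: S_ab_def)
  qed
qed measurable

text \<open>This holds even if \<open>X\<close> is strict: up to the \<open>n\<close>-th sampled
  time the path stays below the integrable variable
  \<open>\<bar>b n\<bar> + X 0 \<omega>\<close>.\<close>

lemma martingale_S: "martingale M G UNIV S"
proof (rule martingaleI_set_nn_integral[OF filtered_G S_adapted integrable_S])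
  fix m n A assume "m \<le> n" and A: "A \<in> sets (G m)"
  show "(\<integral>\<^sup>+\<omega>\<in>A. ennreal (S m \<omega>) \<partial>M) = (\<integral>\<^sup>+\<omega>\<in>A. ennreal (S n \<omega>) \<partial>M)"
    unfolding S_ab_def
    by (rule optional_sampling_dominated[OF stopping_time_tau stopping_time_tau tau_nonneg
          tau_mono[OF _ \<open>m \<le> n\<close>] tau_bounded integrable_bound S_bound])
      (use A in \<open>simp_all add: F_ab_def\<close>)
qed (auto intro: less_imp_le[OF S_pos])

text \<open>A continuous path tending to 0 is bounded, so high levels are never reached and
  eventually the sample is \<open>X\<close> at the deterministic time \<open>a n\<close>.\<close>

lemma S_tendsto_0:
  assumes "AE \<omega> in M. ((\<lambda>t. X t \<omega>) \<longlongrightarrow> 0) at_top"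
  shows "AE \<omega> in M. (\<lambda>n. S n \<omega>) \<longlonglongrightarrow> 0"
  using assms AE_space
proof eventually_elim
  case (elim \<omega>)
  then have \<omega>: "\<omega> \<in> space M" by simp
  have "eventually (\<lambda>t. X t \<omega> < 1) at_top"
    using elim(1) by (rule order_tendstoD) simp
  then obtain T0 where T0: "\<And>t. T0 \<le> t \<Longrightarrow> X t \<omega> < 1"
    by (auto simp: eventually_at_top_linorder)
  have "continuous_on {0..max 0 T0} (\<lambda>s. X s \<omega>)"
    using cont[OF \<omega>] by (rule continuous_on_subset) auto
  then have "\<exists>s\<in>{0..max 0 T0}. \<forall>u\<in>{0..max 0 T0}. X u \<omega> \<le> X s \<omega>"
    by (intro continuous_attains_sup) auto
  then obtain s where s: "\<And>u. u \<in> {0..max 0 T0} \<Longrightarrow> X u \<omega> \<le> X s \<omega>"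
    by blast
  define C where "C = max 1 (X s \<omega>)"
  have C: "X u \<omega> \<le> C" if "0 \<le> u" for u
    using T0[of u] s[of u] that by (cases "u \<le> T0") (auto simp: C_def)
  have "eventually (\<lambda>n. C < b n) sequentially"
    using b by (auto simp: increasing_to_infinity_def filterlim_at_top_dense)
  then have "eventually (\<lambda>n. S n \<omega> = X (a n) \<omega>) sequentially"
    using eventually_ge_at_top[of 1]
  proof eventually_elim
    case (elim n)
    have "\<not> (\<exists>s\<in>{0..a n}. b n \<le> X s \<omega>)"
      using C elim(1) by (metis atLeastAtMost_iff leD order_trans)
    then show ?case
      using truncated_hit_no_hit[OF \<omega>, of "a n" "b n"] a_pos[OF elim(2)] elim(2)
      by (simp add: S_ab_def tau_Suc)
  qed
  moreover have "(\<lambda>n. X (a n) \<omega>) \<longlonglongrightarrow> 0"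
    using a by (intro filterlim_compose[OF elim(1)]) (simp add: increasing_to_infinity_def)
  ultimately show ?case by (simp cong: tendsto_cong)
qed

end

subsection \<open>Drop times of discrete martingales\<close>

lemma less_enat_Suc_iff: "x < enat (Suc n) \<longleftrightarrow> x \<le> enat n"
  by (cases x) auto

text \<open>Each drop consumes at least one index. This allows an initial stretch of indices to be
  skipped by raising the drop count.\<close>

lemma drop_time_ge: "enat k \<le> drop_time S k \<omega>"
proof (induction k)
  case (Suc k)
  show ?case
    unfolding drop_time.simps
  proof (rule Inf_greatest, clarify)
    fix j assume "drop_time S k \<omega> < enat j"
    then have "enat k < enat j" using Suc by (rule le_less_trans[rotated])
    then show "enat (Suc k) \<le> enat j" by simp
  qed
qed (simp add: zero_enat_def)

lemma drop_time_Suc_le_iff: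
  "drop_time S (Suc k) \<omega> \<le> enat n \<longleftrightarrow> (\<exists>j\<le>n. drop_time S k \<omega> < enat j \<and> S j \<omega> < S (j - 1) \<omega>)"
  (is "?L \<longleftrightarrow> ?R")
proof
  let ?A = "{enat j | j. drop_time S k \<omega> < enat j \<and> S j \<omega> < S (j - 1) \<omega>}"
  assume L: ?L
  have "?A \<noteq> {}"
  proof
    assume "?A = {}"
    then have "Inf ?A = \<infinity>" by (simp only: Inf_enat_def simp_thms if_True)
    then show False using L by simp
  qed
  then have "Inf ?A \<in> ?A" by (metis (no_types, lifting) ex_in_conv wellorder_InfI)
  then obtain j where "Inf ?A = enat j" "drop_time S k \<omega> < enat j" "S j \<omega> < S (j - 1) \<omega>"
    by auto
  then show ?R using L by (intro exI[of _ j]) simp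
next
  assume ?R
  then obtain j where j: "j \<le> n" "drop_time S k \<omega> < enat j" "S j \<omega> < S (j - 1) \<omega>" by auto
  then have "drop_time S (Suc k) \<omega> \<le> enat j"
    unfolding drop_time.simps by (intro Inf_lower) auto
  then show ?L using j(1) by (meson enat_ord_simps(1) order_trans)
qed

locale nonneg_martingale =
  fixes M :: "'a measure" and G :: "nat \<Rightarrow> 'a measure" and S :: "nat \<Rightarrow> 'a \<Rightarrow> real"
  assumes mart: "martingale M G UNIV S"
    and nonneg: "\<And>n \<omega>. \<omega> \<in> space M \<Longrightarrow> 0 \<le> S n \<omega>"

sublocale nonneg_martingale \<subseteq> filtered_prob_space M G
  using mart by (simp add: martingale_def)

context nonneg_martingale
begin

lemma S_adapted[measurable]: "S n \<in> borel_measurable (G n)"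
  using mart by (simp add: martingale_def)

lemma integrable_S: "integrable M (S n)"
  using mart by (simp add: martingale_def)

lemma S_measurable[measurable]: "S n \<in> borel_measurable M"
  using integrable_S by simp

lemma drop_time_measurable: "Measurable.pred (G n) (\<lambda>\<omega>. drop_time S k \<omega> \<le> enat n)"
proof (induction k arbitrary: n)
  case 0
  then show ?case by (simp add: zero_enat_def)
next
  case (Suc k)
  have *: "Measurable.pred (G n) (\<lambda>\<omega>. drop_time S k \<omega> < enat j \<and> S j \<omega> < S (j - 1) \<omega>)"
    if "j \<in> {..n}" for j
  proof (cases j)
    \<comment> \<open>An earlier drop before \<open>j\<close> is a drop up to \<open>i\<close>,
      which the induction hypothesis makes measurable at time \<open>i\<close>. The index 0 cannot
      occur, as no drop time is below 0.\<close>
    case (Suc i)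
    have [measurable]: "Measurable.pred (G n) (\<lambda>\<omega>. drop_time S k \<omega> \<le> enat i)"
      "S i \<in> borel_measurable (G n)" "S j \<in> borel_measurable (G n)"
      using that Suc by (auto intro: measurable_F_mono[OF Suc.IH] measurable_F_mono[OF S_adapted])
    have "Measurable.pred (G n) (\<lambda>\<omega>. drop_time S k \<omega> \<le> enat i \<and> S j \<omega> < S i \<omega>)"
      by measurable
    then show ?thesis unfolding Suc less_enat_Suc_iff diff_Suc_1 .
  qed simp
  have "Measurable.pred (G n) (\<lambda>\<omega>. \<exists>j\<in>{..n}. drop_time S k \<omega> < enat j \<and> S j \<omega> < S (j - 1) \<omega>)"
    by (rule pred_intros_finite(4)[OF finite_atMost *])
  then show ?case unfolding drop_time_Suc_le_iff Bex_def atMost_iff .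
qed

end

locale stopped_nonneg_martingale = nonneg_martingale M G S
  for M :: "'a measure" and G S +
  fixes T :: "'a \<Rightarrow> enat"
  assumes stopping: "\<And>n. Measurable.pred (G n) (\<lambda>\<omega>. T \<omega> \<le> enat n)"
begin

lemma stopping_M[measurable]: "Measurable.pred M (\<lambda>\<omega>. T \<omega> \<le> enat n)"
  by (rule measurable_F_imp_M[OF stopping])

text \<open>Optional stopping at the minimum of \<open>T\<close> and \<open>n\<close>, split
  according to which of the two comes earlier.\<close>

lemma stop_decomposition:
  "(\<integral>\<^sup>+\<omega>\<in>{\<omega>\<in>space M. T \<omega> \<le> enat n}. ennreal (value_at S T \<omega>) \<partial>M) +
   (\<integral>\<^sup>+\<omega>\<in>{\<omega>\<in>space M. enat n < T \<omega>}. ennreal (S n \<omega>) \<partial>M) = (\<integral>\<^sup>+\<omega>. ennreal (S 0 \<omega>) \<partial>M)"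
proof -
  let ?A = "{\<omega>\<in>space M. T \<omega> \<le> enat n}" and ?B = "{\<omega>\<in>space M. enat n < T \<omega>}"
  have sets: "{\<omega>\<in>space M. T \<omega> \<le> enat k} \<in> sets (G k)" for k
    using stopping[of k] by (simp add: pred_def space_F)
  \<comment> \<open>On \<open>?A\<close> the time is finite and at most \<open>n\<close>, so
    \<open>the_enat\<close> is meaningful and the minimum with \<open>n\<close> changes no value; it
    bounds the sampled indices by \<open>n\<close>.\<close>
  have "(\<integral>\<^sup>+\<omega>\<in>?A. ennreal (value_at S T \<omega>) \<partial>M) =
      (\<integral>\<^sup>+\<omega>\<in>?A. ennreal (S (min (the_enat (T \<omega>)) n) \<omega>) \<partial>M)"
    by (intro nn_integral_cong)
      (auto simp: value_at_def min_def split: split_indicator enat.splits)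
  also have "\<dots> = (\<integral>\<^sup>+\<omega>\<in>?A. ennreal (S n \<omega>) \<partial>M)"
  proof (rule optional_sampling_countable[OF mart, where r = "\<lambda>k. min k n" and \<kappa> = "\<lambda>\<omega>. the_enat (T \<omega>)"])
    fix k
    show "{\<omega> \<in> ?A. the_enat (T \<omega>) = k} \<in> sets (G (min k n))"
    proof (cases "k \<le> n")
      case True
      have "{\<omega> \<in> ?A. the_enat (T \<omega>) = k} = {\<omega>\<in>space M. T \<omega> \<le> enat k} - {\<omega>\<in>space M. T \<omega> < enat k}"
        using True by (auto split: enat.splits; case_tac "T x") auto
      moreover have "{\<omega>\<in>space M. T \<omega> < enat k} \<in> sets (G k)"
      proof (cases k)
        case (Suc i)
        then show ?thesis using sets[of i] sets_F_mono[of i k] by (auto simp: less_enat_Suc_iff)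
      qed (simp add: zero_enat_def[symmetric])
      ultimately show ?thesis using sets[of k] True by (auto simp: min_def)
    next
      case False
      then have "{\<omega> \<in> ?A. the_enat (T \<omega>) = k} = {}"
        by (auto; case_tac "T x") auto
      then show ?thesis by (metis sets.empty_sets)
    qed
  qed (auto intro: nonneg)
  finally have "(\<integral>\<^sup>+\<omega>\<in>?A. ennreal (value_at S T \<omega>) \<partial>M) + (\<integral>\<^sup>+\<omega>\<in>?B. ennreal (S n \<omega>) \<partial>M) =
      (\<integral>\<^sup>+\<omega>\<in>?A. ennreal (S n \<omega>) \<partial>M) + (\<integral>\<^sup>+\<omega>\<in>?B. ennreal (S n \<omega>) \<partial>M)"
    by simp
  also have "\<dots> = (\<integral>\<^sup>+\<omega>. ennreal (S n \<omega>) * indicator ?A \<omega> + ennreal (S n \<omega>) * indicator ?B \<omega> \<partial>M)"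
    unfolding not_le[symmetric] by (rule nn_integral_add[symmetric]) measurable
  also have "\<dots> = (\<integral>\<^sup>+\<omega>\<in>space M. ennreal (S n \<omega>) \<partial>M)"
    by (intro nn_integral_cong) (auto split: split_indicator)
  also have "\<dots> = (\<integral>\<^sup>+\<omega>\<in>space M. ennreal (S 0 \<omega>) \<partial>M)"
    using sets.top[of "G 0"] by (intro martingale_set_nn_integral[OF mart, symmetric] nonneg) (auto simp: space_F)
  also have "\<dots> = (\<integral>\<^sup>+\<omega>. ennreal (S 0 \<omega>) \<partial>M)"
    by (intro nn_integral_cong) simp
  finally show ?thesis .
qed

lemma value_at_measurable[measurable]: "value_at S T \<in> borel_measurable M"
proof -
  have "T \<in> measurable M (count_space UNIV)"
  proof (subst measurable_count_space_eq2_countable, safe)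
    fix x :: enat
    have "Measurable.pred M (\<lambda>\<omega>. T \<omega> = x)"
    proof (cases x)
      case (enat k)
      have "T \<omega> = x \<longleftrightarrow> T \<omega> \<le> enat k \<and> \<not> (0 < k \<and> T \<omega> \<le> enat (k - 1))" for \<omega>
        unfolding enat by (cases "T \<omega>") auto
      then show ?thesis by simp
    next
      case infinity
      have "T \<omega> = x \<longleftrightarrow> (\<forall>n. \<not> T \<omega> \<le> enat n)" for \<omega>
        unfolding infinity by (cases "T \<omega>") auto
      then show ?thesis by simp
    qed
    then show "T -` {x} \<inter> space M \<in> sets M"
      by (simp add: pred_def vimage_def Int_def conj_commute)
  qed auto
  then have "(\<lambda>\<omega>. case T \<omega> of enat j \<Rightarrow> S j \<omega> | \<infinity> \<Rightarrow> lim (\<lambda>n. S n \<omega>)) \<in> borel_measurable M"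
    by (rule measurable_compose_countable[rotated])
      (simp split: enat.split add: borel_measurable_lim_metric)
  then show ?thesis by (simp add: value_at_def[abs_def])
qed

context
  assumes lim: "AE \<omega> in M. (\<lambda>n. S n \<omega>) \<longlonglongrightarrow> 0"
begin

lemma value_at_nonneg: "AE \<omega> in M. 0 \<le> value_at S T \<omega>"
  using lim AE_space
  by eventually_elim (auto simp: value_at_def limI nonneg split: enat.splits)

text \<open>Paths with \<open>T \<omega> = \<infinity>\<close> contribute nothing, since there the
  value is the limit 0 almost surely. The rest is monotone convergence.\<close>

lemma stopped_value_tendsto:
  "(\<lambda>n. \<integral>\<^sup>+\<omega>\<in>{\<omega>\<in>space M. T \<omega> \<le> enat n}. ennreal (value_at S T \<omega>) \<partial>M) \<longlonglongrightarrow>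
    (\<integral>\<^sup>+\<omega>. ennreal (value_at S T \<omega>) \<partial>M)"
proof -
  let ?f = "\<lambda>n \<omega>. ennreal (value_at S T \<omega>) * indicator {\<omega>\<in>space M. T \<omega> \<le> enat n} \<omega>"
  have inc: "incseq ?f"
    by (intro incseq_SucI le_funI mult_left_mono)
      (auto split: split_indicator elim!: order_trans)
  have "(\<integral>\<^sup>+\<omega>. ennreal (value_at S T \<omega>) \<partial>M) = (\<integral>\<^sup>+\<omega>. (SUP n. ?f n \<omega>) \<partial>M)"
  proof (rule nn_integral_cong_AE)
    show "AE \<omega> in M. ennreal (value_at S T \<omega>) = (SUP n. ?f n \<omega>)"
      using lim AE_space
    proof eventually_elim
      case (elim \<omega>)
      show ?case
      proof (cases "T \<omega>")
        case (enat j)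
        show ?thesis
        proof (rule antisym)
          show "ennreal (value_at S T \<omega>) \<le> (SUP n. ?f n \<omega>)"
            using elim enat by (intro SUP_upper2[of j]) auto
          show "(SUP n. ?f n \<omega>) \<le> ennreal (value_at S T \<omega>)"
            by (intro SUP_least) (auto split: split_indicator)
        qed
      next
        case infinity
        then show ?thesis using elim by (simp add: value_at_def limI)
      qed
    qed
  qed
  also have "\<dots> = (SUP n. \<integral>\<^sup>+\<omega>. ?f n \<omega> \<partial>M)"
    using inc by (rule nn_integral_monotone_convergence_SUP) measurable
  also have "(\<lambda>n. \<integral>\<^sup>+\<omega>. ?f n \<omega> \<partial>M) \<longlonglongrightarrow> \<dots>"
    using inc by (intro LIMSEQ_SUP) (auto simp: incseq_def le_fun_def intro!: nn_integral_mono)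
  finally show ?thesis .
qed

lemma integral_value_at: "(\<integral>\<omega>. value_at S T \<omega> \<partial>M) = enn2real (\<integral>\<^sup>+\<omega>. ennreal (value_at S T \<omega>) \<partial>M)"
  by (intro integral_eq_nn_integral value_at_nonneg) measurable

lemma integral_S0: "(\<integral>\<^sup>+\<omega>. ennreal (S 0 \<omega>) \<partial>M) = ennreal (\<integral>\<omega>. S 0 \<omega> \<partial>M)" "0 \<le> (\<integral>\<omega>. S 0 \<omega> \<partial>M)"
  using integrable_S nonneg by (auto intro!: nn_integral_eq_integral integral_nonneg_AE AE_I2)

lemma value_at_less:
  assumes "0 < \<delta>" "\<And>n. n0 \<le> n \<Longrightarrow> \<delta> \<le> (\<integral>\<^sup>+\<omega>\<in>{\<omega>\<in>space M. enat n < T \<omega>}. ennreal (S n \<omega>) \<partial>M)"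
  shows "(\<integral>\<omega>. value_at S T \<omega> \<partial>M) < (\<integral>\<omega>. S 0 \<omega> \<partial>M)"
proof -
  have "(\<integral>\<^sup>+\<omega>\<in>{\<omega>\<in>space M. T \<omega> \<le> enat n}. ennreal (value_at S T \<omega>) \<partial>M) + \<delta> \<le> ennreal (\<integral>\<omega>. S 0 \<omega> \<partial>M)"
    if "n0 \<le> n" for n
    unfolding integral_S0(1)[symmetric] stop_decomposition[of n, symmetric]
    by (intro add_left_mono assms(2) that)
  then have le: "(\<integral>\<^sup>+\<omega>. ennreal (value_at S T \<omega>) \<partial>M) + \<delta> \<le> ennreal (\<integral>\<omega>. S 0 \<omega> \<partial>M)"
    by (intro LIMSEQ_le_const2[OF tendsto_add[OF stopped_value_tendsto tendsto_const]]) auto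
  have "(\<integral>\<^sup>+\<omega>. ennreal (value_at S T \<omega>) \<partial>M) \<le> (\<integral>\<^sup>+\<omega>. ennreal (value_at S T \<omega>) \<partial>M) + \<delta>"
    by (simp add: add_increasing2)
  also note le
  also have "ennreal (\<integral>\<omega>. S 0 \<omega> \<partial>M) < \<top>" by simp
  \<comment> \<open>Finiteness is what makes adding \<open>\<delta>\<close> a strict increase in
    \<open>ennreal\<close>.\<close>
  finally have fin: "(\<integral>\<^sup>+\<omega>. ennreal (value_at S T \<omega>) \<partial>M) < \<top>" .
  then have "(\<integral>\<^sup>+\<omega>. ennreal (value_at S T \<omega>) \<partial>M) < (\<integral>\<^sup>+\<omega>. ennreal (value_at S T \<omega>) \<partial>M) + \<delta>"
    using ennreal_add_left_cancel_less[of "\<integral>\<^sup>+\<omega>. ennreal (value_at S T \<omega>) \<partial>M" 0 \<delta>] assms(1)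
    by auto
  then show ?thesis
    unfolding integral_value_at enn2real_less_iff[OF fin] using le by (rule less_le_trans)
qed

lemma value_at_ge:
  assumes "\<And>e. 0 < e \<Longrightarrow> \<exists>n. (\<integral>\<^sup>+\<omega>\<in>{\<omega>\<in>space M. enat n < T \<omega>}. ennreal (S n \<omega>) \<partial>M) \<le> ennreal e"
  shows "(\<integral>\<omega>. S 0 \<omega> \<partial>M) \<le> (\<integral>\<omega>. value_at S T \<omega> \<partial>M)"
proof -
  have upper: "(\<integral>\<^sup>+\<omega>\<in>{\<omega>\<in>space M. T \<omega> \<le> enat n}. ennreal (value_at S T \<omega>) \<partial>M) \<le>
      (\<integral>\<^sup>+\<omega>. ennreal (value_at S T \<omega>) \<partial>M)" for n
    by (intro nn_integral_mono) (auto split: split_indicator)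
  have "ennreal (\<integral>\<omega>. S 0 \<omega> \<partial>M) \<le> (\<integral>\<^sup>+\<omega>. ennreal (value_at S T \<omega>) \<partial>M)"
  proof (rule ennreal_le_epsilon)
    fix e :: real assume "0 < e"
    then obtain n where "(\<integral>\<^sup>+\<omega>\<in>{\<omega>\<in>space M. enat n < T \<omega>}. ennreal (S n \<omega>) \<partial>M) \<le> ennreal e"
      using assms by blast
    then show "ennreal (\<integral>\<omega>. S 0 \<omega> \<partial>M) \<le> (\<integral>\<^sup>+\<omega>. ennreal (value_at S T \<omega>) \<partial>M) + ennreal e"
      unfolding integral_S0(1)[symmetric] stop_decomposition[of n, symmetric]
      by (rule add_mono[OF upper])
  qed
  \<comment> \<open>The upper bound excludes \<open>\<top>\<close>, which \<open>enn2real\<close>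
    would turn into 0 in the Bochner integral.\<close>
  moreover have "(\<integral>\<^sup>+\<omega>. ennreal (value_at S T \<omega>) \<partial>M) \<le> ennreal (\<integral>\<omega>. S 0 \<omega> \<partial>M)"
    unfolding integral_S0(1)[symmetric]
  proof (intro LIMSEQ_le_const2[OF stopped_value_tendsto] exI[of _ 0] allI impI)
    fix n
    show "(\<integral>\<^sup>+\<omega>\<in>{\<omega>\<in>space M. T \<omega> \<le> enat n}. ennreal (value_at S T \<omega>) \<partial>M) \<le> (\<integral>\<^sup>+\<omega>. ennreal (S 0 \<omega>) \<partial>M)"
      unfolding stop_decomposition[of n, symmetric] by (simp add: add_increasing2)
  qed
  ultimately have "(\<integral>\<^sup>+\<omega>. ennreal (value_at S T \<omega>) \<partial>M) = ennreal (\<integral>\<omega>. S 0 \<omega> \<partial>M)"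
    by simp
  then show ?thesis
    unfolding integral_value_at using integral_S0(2) by simp
qed

end

end

subsection \<open>Strict local martingales have bubbles\<close>

context sampled_positive_continuous_local_martingale
begin

lemma nonneg_martingale_S: "nonneg_martingale M G S"
  by (intro nonneg_martingale.intro martingale_S less_imp_le[OF S_pos])

lemma stopped_nonneg_martingale_S: "stopped_nonneg_martingale M G S (drop_time S k)"
  by (intro stopped_nonneg_martingale.intro stopped_nonneg_martingale_axioms.intro nonneg_martingale_S
      nonneg_martingale.drop_time_measurable[OF nonneg_martingale_S])

lemma bubble_measure_if_not_martingale:
  assumes lim: "AE \<omega> in M. ((\<lambda>t. X t \<omega>) \<longlongrightarrow> 0) at_top"
    and strict: "\<not> martingale M F {0..} X"
  shows "bubble_measure M G S"
proof -
  obtain T where T: "0 \<le> T" "(\<integral>\<^sup>+\<omega>. ennreal (X T \<omega>) \<partial>M) < (\<integral>\<^sup>+\<omega>. ennreal (X 0 \<omega>) \<partial>M)"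
    using martingaleI_expectation strict by (meson not_le)
  have "eventually (\<lambda>n. T \<le> a n) sequentially"
    using a by (auto simp: increasing_to_infinity_def filterlim_at_top)
  then obtain n1 where n1: "\<And>n. n1 \<le> n \<Longrightarrow> T \<le> a n"
    by (auto simp: eventually_sequentially)
  \<comment> \<open>The successor ensures \<open>n0 \<ge> 1\<close>, since \<open>a\<close> and
    \<open>b\<close> are indexed from 1.\<close>
  define n0 where "n0 = Suc n1"
  have n0: "1 \<le> n0" "\<And>n. n0 \<le> n \<Longrightarrow> T \<le> a n" using n1 by (auto simp: n0_def)
  define \<delta> where "\<delta> = (\<integral>\<^sup>+\<omega>. ennreal (X 0 \<omega>) \<partial>M) - (\<integral>\<^sup>+\<omega>. ennreal (X T \<omega>) \<partial>M)"
  have "0 < \<delta>" using T(2) by (simp add: \<delta>_def diff_gt_0_iff_gt_ennreal)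
  define Hit where "Hit n \<omega> \<longleftrightarrow> (\<exists>s\<in>{0..T}. b n \<le> X s \<omega>)" for n \<omega>
  have [measurable]: "Measurable.pred M (Hit n)" for n
    unfolding Hit_def by (rule measurable_F_imp_M[OF measurable_hit[OF T(1)]])
  \<comment> \<open>A path that reaches \<open>b n\<close> before \<open>T\<close> has reached every
    lower level \<open>b j\<close> as well, and before \<open>a j\<close>.\<close>
  have S_hit: "S j \<omega> = max (b j) (X 0 \<omega>)" if "Hit n \<omega>" "\<omega> \<in> space M" "n0 \<le> j" "j \<le> n" for n j \<omega>
  proof -
    have "b j \<le> b n" using that n0 by (intro b_mono) auto
    then have "\<exists>s\<in>{0..a j}. b j \<le> X s \<omega>"
      using that n0(2)[OF that(3)] unfolding Hit_def
      by (meson atLeastAtMost_iff order_trans)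
    then show ?thesis
      using value_at_truncated_hit[OF that(2), of "a j" "b j"] a_pos[of j] n0 that
      by (simp add: S_ab_def tau_Suc less_imp_le)
  qed
  \<comment> \<open>The drop with number \<open>Suc n0\<close> has an index beyond
    \<open>n0\<close>, where on \<open>Hit n\<close> all samples up to \<open>n\<close> have the
    monotone form of \<open>S_hit\<close>.\<close>
  have no_drop: "enat n < drop_time S (Suc n0) \<omega>" if "n0 \<le> n" "Hit n \<omega>" "\<omega> \<in> space M" for n \<omega>
  proof (rule ccontr)
    assume "\<not> enat n < drop_time S (Suc n0) \<omega>"
    then obtain j where j: "j \<le> n" "drop_time S n0 \<omega> < enat j" "S j \<omega> < S (j - 1) \<omega>"
      using drop_time_Suc_le_iff[of S n0 \<omega> n] by (auto simp: not_less)
    have "enat n0 < enat j" using drop_time_ge[of n0 S \<omega>] j(2) by (rule le_less_trans)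
    then have "n0 < j" by simp
    then have "S j \<omega> = max (b j) (X 0 \<omega>)" "S (j - 1) \<omega> = max (b (j - 1)) (X 0 \<omega>)"
      using that j(1) by (auto intro!: S_hit[of n])
    moreover have "b (j - 1) \<le> b j"
      using \<open>n0 < j\<close> n0(1) by (intro b_mono) auto
    ultimately show False using j(3) by auto
  qed
  have gap: "\<delta> \<le> (\<integral>\<^sup>+\<omega>\<in>{\<omega>\<in>space M. enat n < drop_time S (Suc n0) \<omega>}. ennreal (S n \<omega>) \<partial>M)"
    if n: "n0 \<le> n" for n
  proof -
    \<comment> \<open>Stopping at level \<open>b n\<close> or at \<open>T\<close> preserves the
      expectation of \<open>X 0\<close>. The stopped value is \<open>S n\<close> if the level is
      reached and \<open>X T\<close> if not, so the part with a hit has mass at least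
      \<open>\<delta>\<close>.\<close>
    let ?h = "truncated_hit X (b n) T"
    have [measurable]: "?h \<in> borel_measurable M"
      using sets_F_subset space_F by (intro measurable_stopping_time[OF stopping_time_truncated_hit[OF T(1)]])
    have [measurable]: "X T \<in> borel_measurable M" using measurable_X[OF T(1)] .
    have zero: "stopping_time F (\<lambda>_. 0 :: real)" by (rule stopping_time_const)
    have "(\<integral>\<^sup>+\<omega>. ennreal (X 0 \<omega>) \<partial>M) = (\<integral>\<^sup>+\<omega>\<in>space M. ennreal (X 0 \<omega>) \<partial>M)"
      by (intro nn_integral_cong) simp
    also have "\<dots> = (\<integral>\<^sup>+\<omega>\<in>space M. ennreal (X (?h \<omega>) \<omega>) \<partial>M)"
    proof (rule optional_sampling_dominated[OF zero stopping_time_truncated_hit[OF T(1)] _ _ _ integrable_bound])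
      show "space M \<in> sets (pre_sigma (\<lambda>_. 0 :: real))"
        using sets.top[of "pre_sigma (\<lambda>_. 0 :: real)"] by (simp add: space_pre_sigma)
    qed (auto intro: truncated_hit_nonneg truncated_hit_le[OF T(1)] upto_truncated_hit_bound[OF _ T(1)])
    also have "\<dots> \<le> (\<integral>\<^sup>+\<omega>. ennreal (S n \<omega>) * indicator {\<omega>\<in>space M. Hit n \<omega>} \<omega> + ennreal (X T \<omega>) \<partial>M)"
    proof (rule nn_integral_mono)
      fix \<omega> assume \<omega>: "\<omega> \<in> space M"
      show "ennreal (X (?h \<omega>) \<omega>) * indicator (space M) \<omega> \<le>
          ennreal (S n \<omega>) * indicator {\<omega>\<in>space M. Hit n \<omega>} \<omega> + ennreal (X T \<omega>)"
      proof (cases "Hit n \<omega>")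
        case True
        then have "X (?h \<omega>) \<omega> = S n \<omega>"
          using S_hit[OF True \<omega> n order_refl] value_at_truncated_hit[OF \<omega> T(1), of "b n"]
          by (simp add: Hit_def)
        then show ?thesis using True \<omega> by (simp add: add_increasing2)
      next
        case False
        then have "?h \<omega> = T"
          using truncated_hit_no_hit[OF \<omega> T(1), of "b n"] by (simp add: Hit_def)
        then show ?thesis using False \<omega> by simp
      qed
    qed
    also have "\<dots> = (\<integral>\<^sup>+\<omega>\<in>{\<omega>\<in>space M. Hit n \<omega>}. ennreal (S n \<omega>) \<partial>M) + (\<integral>\<^sup>+\<omega>. ennreal (X T \<omega>) \<partial>M)"
      by (rule nn_integral_add) measurable
    finally have "\<delta> \<le> (\<integral>\<^sup>+\<omega>\<in>{\<omega>\<in>space M. Hit n \<omega>}. ennreal (S n \<omega>) \<partial>M)"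
      unfolding \<delta>_def ennreal_minus_le_iff using expectation_finite[of 0] by (auto simp: add.commute)
    also have "\<dots> \<le> (\<integral>\<^sup>+\<omega>\<in>{\<omega>\<in>space M. enat n < drop_time S (Suc n0) \<omega>}. ennreal (S n \<omega>) \<partial>M)"
      using no_drop[OF n] by (intro nn_integral_mono) (auto split: split_indicator)
    finally show ?thesis .
  qed
  interpret D: stopped_nonneg_martingale M G S "drop_time S (Suc n0)"
    by (rule stopped_nonneg_martingale_S)
  have "(\<integral>\<omega>. value_at S (drop_time S (Suc n0)) \<omega> \<partial>M) < (\<integral>\<omega>. S 0 \<omega> \<partial>M)"
    using D.value_at_less[OF S_tendsto_0[OF lim] \<open>0 < \<delta>\<close> gap] .
  then show ?thesis
    unfolding bubble_measure_def using martingale_S S_pos by (force intro: less_imp_le)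
qed

end

section \<open>Sampling a true martingale along fine partitions\<close>

lemma martingale_subsequence:
  fixes r :: "nat \<Rightarrow> 't::{linorder_topology, second_countable_topology}"
  assumes Y: "martingale M F I Y" and r: "mono r" "\<And>i. r i \<in> I"
  shows "martingale M (\<lambda>i. F (r i)) UNIV (\<lambda>i. Y (r i))"
proof -
  interpret filtered_prob_space M F using Y by (simp add: martingale_def)
  have "filtered_prob_space M (\<lambda>i. F (r i))"
    by (intro filtered_prob_space.intro filtered_prob_space_axioms.intro prob_space_axioms
        sets_F_subset filtration.intro space_F sets_F_mono monoD[OF r(1)])
  then show ?thesis
    using Y r by (auto simp: martingale_def mono_def)
qed

text \<open>Up to the first drop the samples do not decrease, so the value just before it is at
  least the initial one. The loss at that drop is then at most a single increment.\<close>

lemma first_drop: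
  assumes "drop_time S (Suc 0) \<omega> = enat j"
  shows "0 < j" "S 0 \<omega> \<le> S (j - 1) \<omega>"
proof -
  have "drop_time S (Suc 0) \<omega> \<le> enat i \<longleftrightarrow> (\<exists>l\<le>i. 0 < l \<and> S l \<omega> < S (l - 1) \<omega>)" for i
    unfolding drop_time_Suc_le_iff by (simp add: zero_enat_def)
  then have iff: "j \<le> i \<longleftrightarrow> (\<exists>l\<le>i. 0 < l \<and> S l \<omega> < S (l - 1) \<omega>)" for i
    using assms by simp
  show "0 < j" using iff[of j] by auto
  have "S 0 \<omega> \<le> S i \<omega>" if "i < j" for i
    using that
  proof (induction i)
    case (Suc i)
    have "\<not> S (Suc i) \<omega> < S (Suc i - 1) \<omega>" using iff[of "Suc i"] Suc.prems by auto
    then show ?case using Suc by simp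
  qed simp
  then show "S 0 \<omega> \<le> S (j - 1) \<omega>" using \<open>0 < j\<close> by simp
qed

text \<open>The points continue beyond \<open>t\<close> for indices above \<open>p\<close>, which
  gives a process indexed by all of \<open>nat\<close>; only the indices up to \<open>p\<close> form
  the partition.\<close>

definition grid :: "real \<Rightarrow> real \<Rightarrow> nat \<Rightarrow> nat \<Rightarrow> real" where
  "grid s t p i = s + real i * (t - s) / real p"

lemma grid_0 [simp]: "grid s t p 0 = s"
  by (simp add: grid_def)

lemma grid_last [simp]: "0 < p \<Longrightarrow> grid s t p p = t"
  by (simp add: grid_def)

lemma mono_grid: "s \<le> t \<Longrightarrow> mono (grid s t p)"
  by (auto simp: mono_def grid_def intro!: divide_right_mono mult_right_mono)

context positive_continuous_local_martingale
begin

text \<open>The shortfall of the value at the first drop against \<open>X s\<close> is at most one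
  increment of the path over a mesh interval, and uniform continuity on [s, t] makes it
  small.\<close>

lemma grid_defect_tendsto:
  assumes \<omega>: "\<omega> \<in> space M" and st: "0 \<le> s" "s \<le> t"
  defines "Y p i \<equiv> X (grid s t p i)"
  shows "(\<lambda>p. if drop_time (Y p) 1 \<omega> \<le> enat p
      then max 0 (X s \<omega> - value_at (Y p) (drop_time (Y p) 1) \<omega>) else 0) \<longlonglongrightarrow> 0"
  (is "?W \<longlonglongrightarrow> 0")
proof (rule LIMSEQ_I)
  fix e :: real assume "0 < e"
  have "continuous_on {s..t} (\<lambda>u. X u \<omega>)"
    using cont[OF \<omega>] by (rule continuous_on_subset) (use st in auto)
  then have "uniformly_continuous_on {s..t} (\<lambda>u. X u \<omega>)"
    by (rule compact_uniformly_continuous) auto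
  then obtain d where d: "0 < d" "\<And>u v. u \<in> {s..t} \<Longrightarrow> v \<in> {s..t} \<Longrightarrow> dist u v < d \<Longrightarrow> dist (X u \<omega>) (X v \<omega>) < e"
    using \<open>0 < e\<close> unfolding uniformly_continuous_on_def by metis
  obtain P :: nat where P: "(t - s) / d < real P" using reals_Archimedean2 by auto
  have "norm (?W p - 0) < e" if "P \<le> p" for p
  proof (cases "drop_time (Y p) 1 \<omega> \<le> enat p")
    case True
    then obtain j where j: "drop_time (Y p) (Suc 0) \<omega> = enat j" "j \<le> p"
      by (cases "drop_time (Y p) 1 \<omega>") auto
    note drop = first_drop[OF j(1)]
    then have "0 < p" using j by simp
    have in_range: "grid s t p i \<in> {s..t}" if "i \<le> p" for i
      using monoD[OF mono_grid[OF st(2)], of 0 i p] monoD[OF mono_grid[OF st(2)], of i p p] that \<open>0 < p\<close>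
      by simp
    have "(t - s) / d < real p" using P that by linarith
    then have "(t - s) / real p < d" using d(1) \<open>0 < p\<close> by (simp add: field_simps)
    moreover have "grid s t p j - grid s t p (j - 1) = (t - s) / real p"
      using drop(1) \<open>0 < p\<close> by (simp add: grid_def field_simps of_nat_diff)
    ultimately have "dist (grid s t p j) (grid s t p (j - 1)) < d"
      using st by (simp add: dist_real_def)
    then have "dist (grid s t p (j - 1)) (grid s t p j) < d"
      by (simp only: dist_commute)
    then have "dist (X (grid s t p (j - 1)) \<omega>) (X (grid s t p j) \<omega>) < e"
      using j(2) by (intro d(2) in_range) auto
    then have "X s \<omega> - Y p j \<omega> < e"
      using drop(2) by (auto simp: Y_def dist_real_def)
    then show ?thesis
      using j \<open>0 < e\<close> by (simp add: value_at_def)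
  qed (use \<open>0 < e\<close> in simp)
  then show "\<exists>no. \<forall>p\<ge>no. norm (?W p - 0) < e" by blast
qed

end

locale positive_continuous_martingale = positive_continuous_local_martingale M F X
  for M :: "'a measure" and F and X +
  assumes mart: "martingale M F {0..} X"
    and lim: "AE \<omega> in M. ((\<lambda>t. X t \<omega>) \<longlongrightarrow> 0) at_top"
begin

lemma expectation_above_initial_tendsto:
  assumes s: "0 \<le> s"
  shows "(\<lambda>n. \<integral>\<^sup>+\<omega>\<in>{\<omega>\<in>space M. X s \<omega> \<le> X (real n) \<omega>}. ennreal (X s \<omega>) \<partial>M) \<longlonglongrightarrow> 0"
proof -
  have [measurable]: "X s \<in> borel_measurable M" "X (real n) \<in> borel_measurable M" for n
    using s by (auto intro: measurable_X)
  have "(\<lambda>n. \<integral>\<^sup>+\<omega>\<in>{\<omega>\<in>space M. X s \<omega> \<le> X (real n) \<omega>}. ennreal (X s \<omega>) \<partial>M) \<longlonglongrightarrow> (\<integral>\<^sup>+\<omega>. 0 \<partial>M)"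
  proof (rule nn_integral_dominated_convergence[where w = "\<lambda>\<omega>. ennreal (X s \<omega>)"])
    show "AE \<omega> in M. (\<lambda>n. ennreal (X s \<omega>) * indicator {\<omega>\<in>space M. X s \<omega> \<le> X (real n) \<omega>} \<omega>) \<longlonglongrightarrow> 0"
      using lim AE_space
    proof eventually_elim
      case (elim \<omega>)
      then have "(\<lambda>n. X (real n) \<omega>) \<longlonglongrightarrow> 0"
        by (auto intro: filterlim_compose[OF _ filterlim_real_sequentially])
      then have "eventually (\<lambda>n. X (real n) \<omega> < X s \<omega>) sequentially"
        using pos[OF s elim(2)] by (rule order_tendstoD)
      then have "eventually (\<lambda>n. ennreal (X s \<omega>) * indicator {\<omega>\<in>space M. X s \<omega> \<le> X (real n) \<omega>} \<omega> = 0) sequentially"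
        by eventually_elim simp
      then show ?case by (rule tendsto_eventually)
    qed
  qed (use expectation_finite[OF s] in \<open>auto split: split_indicator\<close>)
  then show ?thesis by simp
qed

text \<open>The error \<open>e\<close> is split evenly. One half chooses \<open>t\<close>, making
  E[X_s; X_s at most X_t] small. The other half chooses the mesh, making the expected shortfall at
  the first drop small.\<close>

lemma grid_without_drop_small:
  assumes s: "0 \<le> s" and e: "0 < e"
  shows "\<exists>t p. s + 1 \<le> t \<and> 0 < p \<and>
    (\<integral>\<^sup>+\<omega>\<in>{\<omega>\<in>space M. \<forall>i<p. X (grid s t p i) \<omega> \<le> X (grid s t p (Suc i)) \<omega>}. ennreal (X t \<omega>) \<partial>M) \<le> ennreal e"
proof -
  have "eventually (\<lambda>n. (\<integral>\<^sup>+\<omega>\<in>{\<omega>\<in>space M. X s \<omega> \<le> X (real n) \<omega>}. ennreal (X s \<omega>) \<partial>M) < ennreal (e / 2)) sequentially"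
    using e by (intro order_tendstoD[OF expectation_above_initial_tendsto[OF s]]) simp
  moreover have "eventually (\<lambda>n. s + 1 \<le> real n) sequentially"
    using filterlim_real_sequentially by (simp add: filterlim_at_top)
  ultimately have "eventually (\<lambda>n. s + 1 \<le> real n \<and>
      (\<integral>\<^sup>+\<omega>\<in>{\<omega>\<in>space M. X s \<omega> \<le> X (real n) \<omega>}. ennreal (X s \<omega>) \<partial>M) < ennreal (e / 2)) sequentially"
    by eventually_elim simp
  then obtain n :: nat where n: "s + 1 \<le> real n"
      "(\<integral>\<^sup>+\<omega>\<in>{\<omega>\<in>space M. X s \<omega> \<le> X (real n) \<omega>}. ennreal (X s \<omega>) \<partial>M) < ennreal (e / 2)"
    by (auto simp: eventually_sequentially)
  define t where "t = real n"
  have t: "s \<le> t" "0 \<le> t" using n(1) s by (auto simp: t_def)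
  define Y where "Y p i = X (grid s t p i)" for p i
  define T where "T p = drop_time (Y p) 1" for p
  \<comment> \<open>\<open>W p\<close> is the shortfall at the first drop, put to 0 if no drop
    occurs within the partition. Positivity of \<open>X\<close> bounds it by \<open>X s\<close>,
    which justifies dominated convergence.\<close>
  define W where "W p \<omega> = (if T p \<omega> \<le> enat p then max 0 (X s \<omega> - value_at (Y p) (T p) \<omega>) else 0)" for p \<omega>
  have grid_nonneg: "0 \<le> grid s t p i" for p i
    using s t by (simp add: grid_def)
  have D: "stopped_nonneg_martingale M (\<lambda>i. F (grid s t p i)) (Y p) (T p)" for p
  proof -
    have "nonneg_martingale M (\<lambda>i. F (grid s t p i)) (Y p)"
      unfolding Y_def
      by (intro nonneg_martingale.intro martingale_subsequence[OF mart mono_grid[OF t(1)]]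
          less_imp_le[OF pos]) (auto simp: grid_nonneg)
    then show ?thesis
      unfolding T_def
      by (intro stopped_nonneg_martingale.intro stopped_nonneg_martingale_axioms.intro
          nonneg_martingale.drop_time_measurable)
  qed
  have [measurable]: "X s \<in> borel_measurable M" "X t \<in> borel_measurable M"
    using s t by (auto intro: measurable_X)
  have [measurable]: "value_at (Y p) (T p) \<in> borel_measurable M" for p
    by (rule stopped_nonneg_martingale.value_at_measurable[OF D])
  have [measurable]: "Measurable.pred M (\<lambda>\<omega>. T p \<omega> \<le> enat p)" for p
    by (rule stopped_nonneg_martingale.stopping_M[OF D])
  have "(\<lambda>p. \<integral>\<^sup>+\<omega>. ennreal (W p \<omega>) \<partial>M) \<longlonglongrightarrow> (\<integral>\<^sup>+\<omega>. 0 \<partial>M)"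
  proof (rule nn_integral_dominated_convergence[where w = "\<lambda>\<omega>. ennreal (X s \<omega>)"])
    show "\<And>p. (\<lambda>\<omega>. ennreal (W p \<omega>)) \<in> borel_measurable M"
      unfolding W_def by measurable
    show "AE \<omega> in M. (\<lambda>p. ennreal (W p \<omega>)) \<longlonglongrightarrow> 0"
    proof (rule AE_I2)
      fix \<omega> assume "\<omega> \<in> space M"
      then have "(\<lambda>p. W p \<omega>) \<longlonglongrightarrow> 0"
        unfolding W_def T_def Y_def using s t(1) by (rule grid_defect_tendsto)
      from tendsto_ennrealI[OF this] show "(\<lambda>p. ennreal (W p \<omega>)) \<longlonglongrightarrow> 0" by simp
    qed
    show "AE \<omega> in M. ennreal (W p \<omega>) \<le> ennreal (X s \<omega>)" for p
    proof (intro AE_I2 ennreal_leI)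
      fix \<omega> assume \<omega>: "\<omega> \<in> space M"
      then have "0 \<le> value_at (Y p) (T p) \<omega>" if "T p \<omega> \<le> enat p"
        using that by (cases "T p \<omega>") (auto simp: value_at_def Y_def intro: less_imp_le[OF pos[OF grid_nonneg]])
      then show "W p \<omega> \<le> X s \<omega>"
        using pos[OF s \<omega>] by (auto simp: W_def)
    qed
  qed (use expectation_finite[OF s] in auto)
  then have "eventually (\<lambda>p. (\<integral>\<^sup>+\<omega>. ennreal (W p \<omega>) \<partial>M) < ennreal (e / 2)) sequentially"
    using e by (intro order_tendstoD) auto
  then obtain p where p: "0 < p" "(\<integral>\<^sup>+\<omega>. ennreal (W p \<omega>) \<partial>M) < ennreal (e / 2)"
    by (metis (no_types, lifting) eventually_sequentially le_add1 zero_less_Suc add_Suc_right order_refl le_SucI)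
  let ?v = "\<integral>\<^sup>+\<omega>\<in>{\<omega>\<in>space M. T p \<omega> \<le> enat p}. ennreal (value_at (Y p) (T p) \<omega>) \<partial>M"
  \<comment> \<open>The decomposition is read at index \<open>p\<close>, where the partition has
    arrived at \<open>t\<close>.\<close>
  have decomp: "?v + (\<integral>\<^sup>+\<omega>\<in>{\<omega>\<in>space M. enat p < T p \<omega>}. ennreal (X t \<omega>) \<partial>M) = (\<integral>\<^sup>+\<omega>. ennreal (X s \<omega>) \<partial>M)"
    using stopped_nonneg_martingale.stop_decomposition[OF D, of p p] p(1) by (simp add: Y_def)
  have "(\<integral>\<^sup>+\<omega>. ennreal (X s \<omega>) \<partial>M) \<le>
      (\<integral>\<^sup>+\<omega>. ennreal (value_at (Y p) (T p) \<omega>) * indicator {\<omega>\<in>space M. T p \<omega> \<le> enat p} \<omega> +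
        (ennreal (W p \<omega>) + ennreal (X s \<omega>) * indicator {\<omega>\<in>space M. \<not> T p \<omega> \<le> enat p} \<omega>) \<partial>M)"
  proof (rule nn_integral_mono)
    fix \<omega> assume \<omega>: "\<omega> \<in> space M"
    show "ennreal (X s \<omega>) \<le> ennreal (value_at (Y p) (T p) \<omega>) * indicator {\<omega>\<in>space M. T p \<omega> \<le> enat p} \<omega> +
        (ennreal (W p \<omega>) + ennreal (X s \<omega>) * indicator {\<omega>\<in>space M. \<not> T p \<omega> \<le> enat p} \<omega>)"
    proof (cases "T p \<omega> \<le> enat p")
      case True
      then have "0 \<le> value_at (Y p) (T p) \<omega>"
        using \<omega> by (cases "T p \<omega>") (auto simp: value_at_def Y_def intro: less_imp_le[OF pos[OF grid_nonneg]])
      moreover have "0 \<le> W p \<omega>" "X s \<omega> \<le> value_at (Y p) (T p) \<omega> + W p \<omega>"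
        using True by (auto simp: W_def)
      ultimately have "ennreal (X s \<omega>) \<le> ennreal (value_at (Y p) (T p) \<omega>) + ennreal (W p \<omega>)"
        by (simp add: ennreal_leI flip: ennreal_plus)
      then show ?thesis using True \<omega> by simp
    next
      case False
      then show ?thesis using \<omega> by (simp add: add_increasing)
    qed
  qed
  also have "\<dots> = ?v + ((\<integral>\<^sup>+\<omega>. ennreal (W p \<omega>) \<partial>M) +
      (\<integral>\<^sup>+\<omega>\<in>{\<omega>\<in>space M. \<not> T p \<omega> \<le> enat p}. ennreal (X s \<omega>) \<partial>M))"
    unfolding W_def by (subst nn_integral_add; (subst nn_integral_add)?) measurable
  finally have "?v + (\<integral>\<^sup>+\<omega>\<in>{\<omega>\<in>space M. enat p < T p \<omega>}. ennreal (X t \<omega>) \<partial>M) \<le>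
      ?v + ((\<integral>\<^sup>+\<omega>. ennreal (W p \<omega>) \<partial>M) + (\<integral>\<^sup>+\<omega>\<in>{\<omega>\<in>space M. enat p < T p \<omega>}. ennreal (X s \<omega>) \<partial>M))"
    unfolding decomp by (simp add: not_le)
  moreover have "?v < \<top>"
  proof -
    have "?v \<le> (\<integral>\<^sup>+\<omega>. ennreal (X s \<omega>) \<partial>M)"
      unfolding decomp[symmetric] by (simp add: add_increasing2)
    then show ?thesis using expectation_finite[OF s] by (simp add: le_less_trans)
  qed
  \<comment> \<open>Cancelling the finite mass collected at the first drop shows that
    E[X_t; no drop] exceeds E[X_s; no drop] by at most the expected shortfall.\<close>
  ultimately have le: "(\<integral>\<^sup>+\<omega>\<in>{\<omega>\<in>space M. enat p < T p \<omega>}. ennreal (X t \<omega>) \<partial>M) \<le>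
      (\<integral>\<^sup>+\<omega>. ennreal (W p \<omega>) \<partial>M) + (\<integral>\<^sup>+\<omega>\<in>{\<omega>\<in>space M. enat p < T p \<omega>}. ennreal (X s \<omega>) \<partial>M)"
    by (simp add: ennreal_add_left_cancel_le less_top[symmetric])
  have "(\<integral>\<^sup>+\<omega>\<in>{\<omega>\<in>space M. enat p < T p \<omega>}. ennreal (X s \<omega>) \<partial>M) \<le>
      (\<integral>\<^sup>+\<omega>\<in>{\<omega>\<in>space M. X s \<omega> \<le> X t \<omega>}. ennreal (X s \<omega>) \<partial>M)"
  proof (intro nn_integral_mono mult_left_mono)
    fix \<omega> assume "\<omega> \<in> space M"
    show "(indicator {\<omega>\<in>space M. enat p < T p \<omega>} \<omega> :: ennreal) \<le> indicator {\<omega>\<in>space M. X s \<omega> \<le> X t \<omega>} \<omega>"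
    proof (cases "enat p < T p \<omega>")
      case True
      then have *: "\<not> (\<exists>j\<le>p. 0 < enat j \<and> Y p j \<omega> < Y p (j - 1) \<omega>)"
        using drop_time_Suc_le_iff[of "Y p" 0 \<omega> p] by (simp add: T_def not_le[symmetric])
      have "Y p 0 \<omega> \<le> Y p i \<omega>" if "i \<le> p" for i
        using that
      proof (induction i)
        case (Suc i)
        then have "Y p i \<omega> \<le> Y p (Suc i) \<omega>"
          using * by (auto simp: zero_enat_def not_less dest!: spec[of _ "Suc i"])
        then show ?case using Suc by simp
      qed simp
      from this[of p] have "X s \<omega> \<le> X t \<omega>" using p(1) by (simp add: Y_def)
      then show ?thesis using \<open>\<omega> \<in> space M\<close> by (simp add: indicator_def)
    qed simp
  qed simp
  also have "\<dots> \<le> ennreal (e / 2)"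
    using n(2) by (simp add: t_def)
  finally have "(\<integral>\<^sup>+\<omega>\<in>{\<omega>\<in>space M. enat p < T p \<omega>}. ennreal (X t \<omega>) \<partial>M) \<le> ennreal (e / 2) + ennreal (e / 2)"
    by (intro order_trans[OF le] add_mono less_imp_le[OF p(2)])
  also have "\<dots> = ennreal e"
    using e by (simp flip: ennreal_plus)
  also have "{\<omega>\<in>space M. enat p < T p \<omega>} =
      {\<omega>\<in>space M. \<forall>i<p. X (grid s t p i) \<omega> \<le> X (grid s t p (Suc i)) \<omega>}"
  proof -
    have "enat p < T p \<omega> \<longleftrightarrow> (\<forall>i<p. Y p i \<omega> \<le> Y p (Suc i) \<omega>)" for \<omega>
    proof -
      have "T p \<omega> \<le> enat p \<longleftrightarrow> (\<exists>j\<le>p. 0 < j \<and> Y p j \<omega> < Y p (j - 1) \<omega>)"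
        using drop_time_Suc_le_iff[of "Y p" 0 \<omega> p] by (simp add: T_def zero_enat_def)
      also have "\<dots> \<longleftrightarrow> (\<exists>i<p. Y p (Suc i) \<omega> < Y p i \<omega>)"
        by (metis Suc_diff_1 Suc_le_eq diff_Suc_1 zero_less_Suc)
      finally show ?thesis by (meson not_le)
    qed
    then show ?thesis by (simp add: Y_def)
  qed
  finally show ?thesis
    using n(1) p(1) by (intro exI[of _ t] exI[of _ p]) (simp add: t_def)
qed

text \<open>Continuous paths are bounded on [0, T], so the hitting events shrink to the empty set,
  and \<open>X T\<close> dominates. All \<open>c\<close> above the threshold are covered because the
  levels must also increase and diverge.\<close>

lemma hit_expectation_small:
  assumes T: "0 \<le> T" and e: "0 < e"
  shows "\<exists>c0. \<forall>c\<ge>c0. (\<integral>\<^sup>+\<omega>\<in>{\<omega>\<in>space M. \<exists>s\<in>{0..T}. c \<le> X s \<omega>}. ennreal (X T \<omega>) \<partial>M) \<le> ennreal e"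
proof -
  have [measurable]: "X T \<in> borel_measurable M" using measurable_X[OF T] .
  have [measurable]: "Measurable.pred M (\<lambda>\<omega>. \<exists>s\<in>{0..T}. c \<le> X s \<omega>)" for c
    by (rule measurable_F_imp_M[OF measurable_hit[OF T]])
  have "(\<lambda>n. \<integral>\<^sup>+\<omega>\<in>{\<omega>\<in>space M. \<exists>s\<in>{0..T}. real n \<le> X s \<omega>}. ennreal (X T \<omega>) \<partial>M) \<longlonglongrightarrow> (\<integral>\<^sup>+\<omega>. 0 \<partial>M)"
  proof (rule nn_integral_dominated_convergence[where w = "\<lambda>\<omega>. ennreal (X T \<omega>)"])
    show "AE \<omega> in M. (\<lambda>n. ennreal (X T \<omega>) * indicator {\<omega>\<in>space M. \<exists>s\<in>{0..T}. real n \<le> X s \<omega>} \<omega>) \<longlonglongrightarrow> 0"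
    proof (rule AE_I2)
      fix \<omega> assume \<omega>: "\<omega> \<in> space M"
      have "continuous_on {0..T} (\<lambda>s. X s \<omega>)"
        using cont[OF \<omega>] by (rule continuous_on_subset) auto
      then have "\<exists>u\<in>{0..T}. \<forall>s\<in>{0..T}. X s \<omega> \<le> X u \<omega>"
        using T by (intro continuous_attains_sup) auto
      then obtain C where C: "\<And>s. s \<in> {0..T} \<Longrightarrow> X s \<omega> \<le> C" by blast
      have "eventually (\<lambda>n. C < real n) sequentially"
        using filterlim_real_sequentially by (simp add: filterlim_at_top_dense)
      then have "eventually (\<lambda>n. ennreal (X T \<omega>) * indicator {\<omega>\<in>space M. \<exists>s\<in>{0..T}. real n \<le> X s \<omega>} \<omega> = 0) sequentially"
      proof eventually_elim
        case (elim n)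
        then have "\<not> (\<exists>s\<in>{0..T}. real n \<le> X s \<omega>)"
          using C by (meson leD order_trans)
        then show ?case by simp
      qed
      then show "(\<lambda>n. ennreal (X T \<omega>) * indicator {\<omega>\<in>space M. \<exists>s\<in>{0..T}. real n \<le> X s \<omega>} \<omega>) \<longlonglongrightarrow> 0"
        by (rule tendsto_eventually)
    qed
  qed (use expectation_finite[OF T] in \<open>auto split: split_indicator\<close>)
  then have "eventually (\<lambda>n. (\<integral>\<^sup>+\<omega>\<in>{\<omega>\<in>space M. \<exists>s\<in>{0..T}. real n \<le> X s \<omega>}. ennreal (X T \<omega>) \<partial>M) < ennreal e) sequentially"
    using e by (intro order_tendstoD) auto
  then obtain n :: nat where n: "(\<integral>\<^sup>+\<omega>\<in>{\<omega>\<in>space M. \<exists>s\<in>{0..T}. real n \<le> X s \<omega>}. ennreal (X T \<omega>) \<partial>M) < ennreal e"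
    by (auto simp: eventually_sequentially)
  show ?thesis
  proof (intro exI[of _ "real n"] allI impI)
    fix c assume "real n \<le> c"
    then have "(\<integral>\<^sup>+\<omega>\<in>{\<omega>\<in>space M. \<exists>s\<in>{0..T}. c \<le> X s \<omega>}. ennreal (X T \<omega>) \<partial>M) \<le>
        (\<integral>\<^sup>+\<omega>\<in>{\<omega>\<in>space M. \<exists>s\<in>{0..T}. real n \<le> X s \<omega>}. ennreal (X T \<omega>) \<partial>M)"
      by (intro nn_integral_mono mult_left_mono)
        (auto split: split_indicator intro: order_trans)
    then show "(\<integral>\<^sup>+\<omega>\<in>{\<omega>\<in>space M. \<exists>s\<in>{0..T}. c \<le> X s \<omega>}. ennreal (X T \<omega>) \<partial>M) \<le> ennreal e"
      using n by (meson less_imp_le order_trans)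
  qed
qed

end

subsection \<open>A sampling without bubble\<close>

text \<open>Whether the level is reached by \<open>T\<close> is known at the truncated hitting time.
  Optional sampling can therefore be restricted to this event.\<close>

lemma (in positive_continuous_local_martingale) hit_in_pre_sigma:
  assumes T: "0 \<le> T"
  shows "{\<omega>\<in>space M. \<exists>s\<in>{0..T}. c \<le> X s \<omega>} \<in> sets (pre_sigma (truncated_hit X c T))"
proof (rule sets_pre_sigmaI[OF stopping_time_truncated_hit[OF T]])
  fix t
  let ?H = "\<lambda>t. {\<omega>\<in>space M. \<exists>s\<in>{0..t}. c \<le> X s \<omega>}"
  have H: "0 \<le> t \<Longrightarrow> ?H t \<in> sets (F t)" for t
    using measurable_hit[of t c] by (simp add: pred_def space_F)
  consider "t < 0" | "0 \<le> t" "t < T" | "T \<le> t" by linarith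
  then show "{\<omega>\<in>?H T. truncated_hit X c T \<omega> \<le> t} \<in> sets (F t)"
  proof cases
    case 1
    then have "{\<omega>\<in>?H T. truncated_hit X c T \<omega> \<le> t} = {}"
      using less_le_trans[OF _ truncated_hit_nonneg] by (auto simp: not_le)
    then show ?thesis by (metis sets.empty_sets)
  next
    case 2
    then have "{\<omega>\<in>?H T. truncated_hit X c T \<omega> \<le> t} = ?H t"
      using truncated_hit_le_iff[OF _ 2(1) T, of _ c] by force
    then show ?thesis using H[OF 2(1)] by simp
  next
    case 3
    then have "{\<omega>\<in>?H T. truncated_hit X c T \<omega> \<le> t} = ?H T"
      using truncated_hit_le[OF T] order_trans by blast
    then show ?thesis using H[OF T] sets_F_mono[OF 3] by auto
  qed
qed

text \<open>The \<open>m j\<close> are the end points of the intervals, \<open>p j\<close> their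
  numbers of pieces, and \<open>\<beta> j\<close> the levels. The lower bounds on steps and levels
  force both sequences to infinity.\<close>

locale block_sequence =
  fixes m :: "nat \<Rightarrow> real" and p :: "nat \<Rightarrow> nat" and \<beta> :: "nat \<Rightarrow> real"
  assumes m_0: "1 \<le> m 0" and m_step: "\<And>j. m j + 1 \<le> m (Suc j)" and p_pos: "\<And>j. 0 < p j"
    and \<beta>: "\<And>j. real (Suc j) \<le> \<beta> j" "mono \<beta>"
begin

text \<open>
  Block \<open>j\<close> consists of the indices \<open>N j < n \<le> N (Suc j)\<close>. It runs through the \<open>p j + 1\<close> points of the
  partition of \<open>[m j, m (Suc j)]\<close>, all at the level \<open>\<beta> j\<close>. The common end point of two consecutive
  intervals is sampled twice, so that every block has a single level.
\<close>

definition N :: "nat \<Rightarrow> nat" where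
  "N j = (\<Sum>i<j. Suc (p i))"

text \<open>The index 0 precedes all blocks and is assigned to block 0.\<close>

definition blk :: "nat \<Rightarrow> nat" where
  "blk n = (LEAST j. n \<le> N (Suc j))"

definition a :: "nat \<Rightarrow> real" where
  "a n = grid (m (blk n)) (m (Suc (blk n))) (p (blk n)) (n - Suc (N (blk n)))"

definition b :: "nat \<Rightarrow> real" where
  "b n = \<beta> (blk n)"

lemma N_0: "N 0 = 0" and N_Suc: "N (Suc j) = N j + Suc (p j)"
  by (simp_all add: N_def)

lemma N_mono: "i \<le> j \<Longrightarrow> N i \<le> N j"
  unfolding N_def by (intro sum_mono2) auto

lemma N_ge: "j \<le> N j"
  by (induction j) (auto simp: N_Suc)

lemma blk_le: "n \<le> N (Suc (blk n))"
  unfolding blk_def by (rule LeastI[of _ n]) (use N_ge[of "Suc n"] in simp)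

lemma blk_mono: "n \<le> n' \<Longrightarrow> blk n \<le> blk n'"
  unfolding blk_def[of n] using blk_le[of n'] by (intro Least_le) simp

lemma blk_eq: "N j < n \<Longrightarrow> n \<le> N (Suc j) \<Longrightarrow> blk n = j"
  unfolding blk_def
proof (rule Least_equality)
  fix y assume "N j < n" "n \<le> N (Suc y)"
  then show "j \<le> y" using N_mono[of "Suc y" j] by (force simp: not_le[symmetric] Suc_le_eq)
qed

lemma less_blk: "N j < n \<Longrightarrow> j \<le> blk n"
  using blk_le[of n] N_mono[of "Suc (blk n)" j] by (force simp: not_le[symmetric] Suc_le_eq)

lemma N_blk_less: "1 \<le> n \<Longrightarrow> N (blk n) < n"
proof (cases "blk n")
  case (Suc j)
  then have "\<not> n \<le> N (Suc j)" unfolding blk_def by (metis lessI not_less_Least)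
  then show ?thesis using Suc by simp
qed (simp add: N_0)

lemma m_mono: "m j \<le> m (Suc j)"
  using m_step[of j] by simp

lemma m_ge: "real (Suc j) \<le> m j"
proof (induction j)
  case (Suc j)
  then show ?case using m_step[of j] by simp
qed (use m_0 in simp)

lemma a_block: "i \<le> p j \<Longrightarrow> a (Suc (N j + i)) = grid (m j) (m (Suc j)) (p j) i"
  and b_block: "i \<le> p j \<Longrightarrow> b (Suc (N j + i)) = \<beta> j"
  using blk_eq[of j "Suc (N j + i)"] by (simp_all add: a_def b_def N_Suc)

lemma a_ge: "real (Suc (blk n)) \<le> a n"
  using monoD[OF mono_grid[OF m_mono], of 0 "n - Suc (N (blk n))" "blk n" "p (blk n)"] m_ge[of "blk n"]
  by (simp add: a_def)

lemma a_Suc: "1 \<le> n \<Longrightarrow> a n \<le> a (Suc n)"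
proof -
  assume "1 \<le> n"
  define j where "j = blk n"
  define i where "i = n - Suc (N j)"
  have "N j < n" "n \<le> N (Suc j)"
    using N_blk_less[OF \<open>1 \<le> n\<close>] blk_le[of n] by (auto simp: j_def)
  then have i: "n = Suc (N j + i)" "i \<le> p j" by (auto simp: i_def N_Suc)
  show ?thesis
  proof (cases "i < p j")
    case True
    then show ?thesis
      using a_block[of i j] a_block[of "Suc i" j] monoD[OF mono_grid[OF m_mono], of i "Suc i" j "p j"]
      by (simp add: i)
  next
    case False
    \<comment> \<open>The last index of block \<open>j\<close> and the first of the next block share
      the time \<open>m (Suc j)\<close>.\<close>
    then have "i = p j" using i by simp
    then have "a n = m (Suc j)" "a (Suc n) = m (Suc j)"
      using a_block[of i j] a_block[of 0 "Suc j"] p_pos[of j] by (auto simp: i N_Suc)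
    then show ?thesis by simp
  qed
qed

lemma filterlim_blk: "filterlim blk at_top sequentially"
  unfolding filterlim_at_top
proof
  fix j
  show "eventually (\<lambda>n. j \<le> blk n) sequentially"
    using eventually_gt_at_top[of "N j"] by eventually_elim (rule less_blk)
qed

lemma filterlim_Suc_blk: "filterlim (\<lambda>n. real (Suc (blk n))) at_top sequentially"
  by (rule filterlim_compose[OF filterlim_real_sequentially])
    (rule filterlim_compose[OF filterlim_Suc filterlim_blk])

lemma increasing_a: "increasing_to_infinity a"
  unfolding increasing_to_infinity_def
proof (intro conjI allI impI)
  show "0 < a n" for n
    using a_ge[of n] by simp
  show "mono_on {1..} a"
  proof (rule mono_onI)
    fix x y :: nat assume "x \<in> {1..}" "y \<in> {1..}" "x \<le> y"
    then have "a (Suc (x - 1)) \<le> a (Suc (y - 1))"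
      by (intro lift_Suc_mono_le[of "\<lambda>n. a (Suc n)" "x - 1" "y - 1", OF a_Suc]) auto
    then show "a x \<le> a y" using \<open>x \<in> {1..}\<close> \<open>y \<in> {1..}\<close> by simp
  qed
  show "filterlim a at_top sequentially"
    by (rule filterlim_at_top_mono[OF filterlim_Suc_blk]) (simp add: a_ge del: of_nat_Suc)
qed

lemma increasing_b: "increasing_to_infinity b"
  unfolding increasing_to_infinity_def
proof (intro conjI allI impI)
  show "0 < b n" for n
    unfolding b_def using \<beta>(1)[of "blk n"] by simp
  show "mono_on {1..} b"
    unfolding b_def by (intro mono_onI monoD[OF \<beta>(2)] blk_mono)
  show "filterlim b at_top sequentially"
    by (rule filterlim_at_top_mono[OF filterlim_Suc_blk]) (simp add: b_def \<beta>(1) del: of_nat_Suc)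
qed

text \<open>Pigeonhole: a drop inside each of the \<open>k\<close> blocks would give
  \<open>k\<close> drops by the end of the last one.\<close>

lemma block_without_drop:
  fixes S :: "nat \<Rightarrow> 'a \<Rightarrow> real"
  assumes "enat (N (J + k)) < drop_time S k \<omega>"
  shows "\<exists>j\<in>{J..<J + k}. \<forall>i<p j. S (Suc (N j + i)) \<omega> \<le> S (Suc (N j + Suc i)) \<omega>"
  using assms
proof (induction k)
  case 0
  then show ?case by (simp add: zero_enat_def)
next
  case (Suc k)
  show ?case
  proof (cases "enat (N (J + k)) < drop_time S k \<omega>")
    case True
    then obtain j where "j \<in> {J..<J + k}" "\<forall>i<p j. S (Suc (N j + i)) \<omega> \<le> S (Suc (N j + Suc i)) \<omega>"
      using Suc.IH by blast
    then show ?thesis by (intro bexI[of _ j]) auto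
  next
    case False
    \<comment> \<open>The \<open>k\<close>-th drop has occurred by the end of the earlier blocks, so
      any drop inside the new block would complete \<open>k + 1\<close> drops by its end.\<close>
    have "S (Suc (N (J + k) + i)) \<omega> \<le> S (Suc (N (J + k) + Suc i)) \<omega>" if "i < p (J + k)" for i
    proof (rule ccontr)
      let ?l = "Suc (N (J + k) + Suc i)"
      assume "\<not> ?thesis"
      moreover have "?l \<le> N (J + Suc k)" using that by (simp add: N_Suc)
      moreover have "drop_time S k \<omega> \<le> enat (N (J + k))" using False by simp
      then have "drop_time S k \<omega> < enat ?l" by (rule le_less_trans) simp
      ultimately have "drop_time S (Suc k) \<omega> \<le> enat (N (J + Suc k))"
        unfolding drop_time_Suc_le_iff by (intro exI[of _ ?l]) (auto simp: not_le)
      then show False using Suc.prems by (simp add: not_le[symmetric])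
    qed
    then show ?thesis by (intro bexI[of _ "J + k"]) auto
  qed
qed

end

locale block_sampled_martingale = positive_continuous_martingale M F X + block_sequence m p \<beta>
  for M :: "'a measure" and F X m p \<beta> +
  assumes no_drop_small: "\<And>j. (\<integral>\<^sup>+\<omega>\<in>{\<omega>\<in>space M. \<forall>i<p j. X (grid (m j) (m (Suc j)) (p j) i) \<omega> \<le>
        X (grid (m j) (m (Suc j)) (p j) (Suc i)) \<omega>}. ennreal (X (m (Suc j)) \<omega>) \<partial>M) \<le> ennreal (1 / real (Suc j))"
    and hit_small: "\<And>j. (\<integral>\<^sup>+\<omega>\<in>{\<omega>\<in>space M. \<exists>s\<in>{0..m (Suc j)}. \<beta> j \<le> X s \<omega>}. ennreal (X (m (Suc j)) \<omega>) \<partial>M) \<le>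
        ennreal (1 / real (Suc j))"

sublocale block_sampled_martingale \<subseteq> sampled_positive_continuous_local_martingale M F X a b
  by unfold_locales (rule increasing_a, rule increasing_b)

context block_sampled_martingale
begin

text \<open>Only steps inside the block are compared; the step into its first index
  \<open>Suc (N j)\<close> is left out.\<close>

definition no_drop :: "nat \<Rightarrow> 'a set" where
  "no_drop j = {\<omega>\<in>space M. \<forall>i<p j. S (Suc (N j + i)) \<omega> \<le> S (Suc (N j + Suc i)) \<omega>}"

lemma S_block:
  assumes \<omega>: "\<omega> \<in> space M" and i: "i \<le> p j"
    and no_hit: "\<not> (\<exists>s\<in>{0..m (Suc j)}. \<beta> j \<le> X s \<omega>)"
  shows "S (Suc (N j + i)) \<omega> = X (grid (m j) (m (Suc j)) (p j) i) \<omega>"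
proof -
  have le: "a (Suc (N j + i)) \<le> m (Suc j)"
    using monoD[OF mono_grid[OF m_mono], of i "p j" j "p j"] i p_pos[of j] by (simp add: a_block)
  have "\<not> (\<exists>s\<in>{0..a (Suc (N j + i))}. b (Suc (N j + i)) \<le> X s \<omega>)"
    using no_hit le i by (auto simp: b_block)
  then have "S (Suc (N j + i)) \<omega> = X (a (Suc (N j + i))) \<omega>"
    using truncated_hit_no_hit[OF \<omega>, of "a (Suc (N j + i))" "b (Suc (N j + i))"] a_pos[of "Suc (N j + i)"]
    by (simp add: S_ab_def tau_Suc)
  then show ?thesis using i by (simp add: a_block)
qed

text \<open>If the level is not reached, the samples are \<open>X\<close> along the partition and
  \<open>no_drop_small\<close> applies. If it is reached, the path may be frozen without drops and
  \<open>hit_small\<close> applies. Each case costs \<open>1 / (j + 1)\<close>.\<close>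

lemma no_drop_block_small:
  "(\<integral>\<^sup>+\<omega>\<in>no_drop j. ennreal (S (N (Suc j)) \<omega>) \<partial>M) \<le> ennreal (2 / real (Suc j))"
proof -
  let ?T = "m (Suc j)" and ?n = "N (Suc j)"
  let ?H = "{\<omega>\<in>space M. \<exists>s\<in>{0..?T}. \<beta> j \<le> X s \<omega>}"
  let ?D = "{\<omega>\<in>space M. \<forall>i<p j. X (grid (m j) ?T (p j) i) \<omega> \<le> X (grid (m j) ?T (p j) (Suc i)) \<omega>}"
  have T: "0 \<le> ?T" using m_ge[of "Suc j"] by simp
  have n: "?n = Suc (N j + p j)" by (simp add: N_Suc)
  have ab: "a ?n = ?T" "b ?n = \<beta> j"
    using a_block[of "p j" j] b_block[of "p j" j] p_pos[of j] by (simp_all add: n)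
  have \<tau>_n: "\<tau> ?n = truncated_hit X (\<beta> j) ?T"
    using tau_Suc[of ?n] unfolding ab by (simp add: n)
  have [measurable]: "X ?T \<in> borel_measurable M" using measurable_X[OF T] .
  have [measurable]: "X (grid (m j) ?T (p j) i) \<in> borel_measurable M" for i
    using m_ge[of j] m_mono[of j] by (intro measurable_X) (simp add: grid_def)
  have [measurable]: "?H \<in> sets M"
    using measurable_F_imp_M[OF measurable_hit[OF T]] by (simp add: pred_def)
  have [measurable]: "?D \<in> sets M" by measurable
  have "(\<integral>\<^sup>+\<omega>\<in>no_drop j. ennreal (S ?n \<omega>) \<partial>M) \<le>
      (\<integral>\<^sup>+\<omega>. ennreal (S ?n \<omega>) * indicator ?H \<omega> + ennreal (X ?T \<omega>) * indicator ?D \<omega> \<partial>M)"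
  proof (rule nn_integral_mono)
    fix \<omega> assume \<omega>: "\<omega> \<in> space M"
    show "ennreal (S ?n \<omega>) * indicator (no_drop j) \<omega> \<le>
        ennreal (S ?n \<omega>) * indicator ?H \<omega> + ennreal (X ?T \<omega>) * indicator ?D \<omega>"
    proof (cases "\<omega> \<in> ?H")
      case True
      then show ?thesis by (auto simp: add_increasing2 split: split_indicator)
    next
      case False
      then have S_eq: "i \<le> p j \<Longrightarrow> S (Suc (N j + i)) \<omega> = X (grid (m j) ?T (p j) i) \<omega>" for i
        using S_block[OF \<omega>] \<omega> by blast
      have "S ?n \<omega> = X ?T \<omega>"
        using S_eq[of "p j"] p_pos[of j] by (simp add: n)
      moreover have "\<omega> \<in> ?D" if "\<omega> \<in> no_drop j"
        using that S_eq unfolding no_drop_def by (auto simp: Suc_le_eq simp del: add_Suc_right)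
      ultimately show ?thesis by (auto split: split_indicator)
    qed
  qed
  also have "\<dots> = (\<integral>\<^sup>+\<omega>\<in>?H. ennreal (S ?n \<omega>) \<partial>M) + (\<integral>\<^sup>+\<omega>\<in>?D. ennreal (X ?T \<omega>) \<partial>M)"
    by (rule nn_integral_add) measurable
  \<comment> \<open>Here the martingale property of \<open>X\<close> enters: the mass at the reached
    level equals E[X_T; hit], which \<open>hit_small\<close> controls.\<close>
  also have "(\<integral>\<^sup>+\<omega>\<in>?H. ennreal (S ?n \<omega>) \<partial>M) = (\<integral>\<^sup>+\<omega>\<in>?H. ennreal (X ?T \<omega>) \<partial>M)"
    unfolding S_ab_def \<tau>_n
    by (rule optional_sampling_continuous[OF mart less_imp_le[OF pos] cont
          stopping_time_truncated_hit[OF T] truncated_hit_nonneg truncated_hit_le[OF T] T hit_in_pre_sigma[OF T]])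
  also have "\<dots> + (\<integral>\<^sup>+\<omega>\<in>?D. ennreal (X ?T \<omega>) \<partial>M) \<le> ennreal (1 / real (Suc j)) + ennreal (1 / real (Suc j))"
    by (intro add_mono hit_small no_drop_small)
  also have "\<dots> = ennreal (2 / real (Suc j))"
    by (simp flip: ennreal_plus)
  finally show ?thesis .
qed

lemma no_drop_measurable: "no_drop j \<in> sets (G (N (Suc j)))"
proof -
  interpret G: filtered_prob_space M G by (rule filtered_G)
  have S_meas: "S (Suc (N j + i)) \<in> borel_measurable (G (N (Suc j)))" if "i \<le> p j" for i
    using that by (intro G.measurable_F_mono[OF S_adapted]) (simp add: N_Suc)
  have "{\<omega>\<in>space (G (N (Suc j))). \<forall>i\<in>{..<p j}. S (Suc (N j + i)) \<omega> \<le> S (Suc (N j + Suc i)) \<omega>} \<in> sets (G (N (Suc j)))"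
    by (intro sets.sets_Collect_finite_All borel_measurable_le S_meas) auto
  then show ?thesis
    by (simp only: no_drop_def G.space_F Ball_def lessThan_iff)
qed

text \<open>A union bound over the block without a drop supplied by the pigeonhole argument.\<close>

lemma expectation_before_drop_le:
  "(\<integral>\<^sup>+\<omega>\<in>{\<omega>\<in>space M. enat (N (J + k)) < drop_time S k \<omega>}. ennreal (S (N (J + k)) \<omega>) \<partial>M) \<le>
    ennreal (real k * (2 / real (Suc J)))"
proof -
  let ?n = "N (J + k)"
  have [measurable]: "no_drop j \<in> sets M" for j
    using no_drop_measurable sets_G_subset by blast
  have "(\<integral>\<^sup>+\<omega>\<in>{\<omega>\<in>space M. enat ?n < drop_time S k \<omega>}. ennreal (S ?n \<omega>) \<partial>M) \<le>
      (\<integral>\<^sup>+\<omega>. (\<Sum>j\<in>{J..<J + k}. ennreal (S ?n \<omega>) * indicator (no_drop j) \<omega>) \<partial>M)"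
  proof (rule nn_integral_mono)
    fix \<omega> assume \<omega>: "\<omega> \<in> space M"
    show "ennreal (S ?n \<omega>) * indicator {\<omega>\<in>space M. enat ?n < drop_time S k \<omega>} \<omega> \<le>
        (\<Sum>j\<in>{J..<J + k}. ennreal (S ?n \<omega>) * indicator (no_drop j) \<omega>)"
    proof (cases "enat ?n < drop_time S k \<omega>")
      case True
      then obtain j where j: "j \<in> {J..<J + k}" "\<omega> \<in> no_drop j"
        using block_without_drop[OF True] \<omega> by (auto simp: no_drop_def)
      then have "ennreal (S ?n \<omega>) * indicator (no_drop j) \<omega> \<le>
          (\<Sum>j\<in>{J..<J + k}. ennreal (S ?n \<omega>) * indicator (no_drop j) \<omega>)"
        by (intro member_le_sum) auto
      then show ?thesis using j True \<omega> by simp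
    qed simp
  qed
  also have "\<dots> = (\<Sum>j\<in>{J..<J + k}. \<integral>\<^sup>+\<omega>\<in>no_drop j. ennreal (S ?n \<omega>) \<partial>M)"
    by (rule nn_integral_sum) measurable
  also have "\<dots> \<le> (\<Sum>j\<in>{J..<J + k}. ennreal (2 / real (Suc J)))"
  proof (rule sum_mono)
    fix j assume j: "j \<in> {J..<J + k}"
    \<comment> \<open>The event is decided at the end of block \<open>j\<close>, so the sampled
      martingale can be moved back there from the later index.\<close>
    have "(\<integral>\<^sup>+\<omega>\<in>no_drop j. ennreal (S ?n \<omega>) \<partial>M) = (\<integral>\<^sup>+\<omega>\<in>no_drop j. ennreal (S (N (Suc j)) \<omega>) \<partial>M)"
      using j by (intro martingale_set_nn_integral[OF martingale_S, symmetric] no_drop_measurable N_mono)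
        (auto intro: less_imp_le[OF S_pos])
    also have "\<dots> \<le> ennreal (2 / real (Suc j))" by (rule no_drop_block_small)
    also have "\<dots> \<le> ennreal (2 / real (Suc J))"
      using j by (intro ennreal_leI divide_left_mono) auto
    finally show "(\<integral>\<^sup>+\<omega>\<in>no_drop j. ennreal (S ?n \<omega>) \<partial>M) \<le> ennreal (2 / real (Suc J))" .
  qed
  also have "\<dots> = ennreal (real k * (2 / real (Suc J)))"
    by (simp add: ennreal_of_nat_eq_real_of_nat del: of_nat_Suc flip: ennreal_mult)
  finally show ?thesis .
qed

lemma not_bubble_measure: "\<not> bubble_measure M G S"
proof
  assume "bubble_measure M G S"
  then obtain k where k: "(\<integral>\<omega>. value_at S (drop_time S k) \<omega> \<partial>M) < (\<integral>\<omega>. S 0 \<omega> \<partial>M)"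
    unfolding bubble_measure_def by blast
  interpret D: stopped_nonneg_martingale M G S "drop_time S k"
    by (rule stopped_nonneg_martingale_S)
  have "(\<integral>\<omega>. S 0 \<omega> \<partial>M) \<le> (\<integral>\<omega>. value_at S (drop_time S k) \<omega> \<partial>M)"
  proof (rule D.value_at_ge[OF S_tendsto_0[OF lim]])
    fix e :: real assume "0 < e"
    \<comment> \<open>The count \<open>k\<close> is fixed by the supposed bubble, so the starting
      block can be taken late enough to make the bound at most \<open>e\<close>.\<close>
    obtain J :: nat where J: "2 * real k / e < real J" using reals_Archimedean2 by auto
    then have "real k * (2 / real (Suc J)) \<le> e"
      using \<open>0 < e\<close> by (simp add: field_simps)
    then show "\<exists>n. (\<integral>\<^sup>+\<omega>\<in>{\<omega>\<in>space M. enat n < drop_time S k \<omega>}. ennreal (S n \<omega>) \<partial>M) \<le> ennreal e"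
      using expectation_before_drop_le[of J k] by (meson ennreal_leI order_trans)
  qed
  then show False using k by simp
qed

end

lemma (in positive_continuous_martingale) exists_sampling_without_bubble:
  "\<exists>a b. increasing_to_infinity a \<and> increasing_to_infinity b \<and> \<not> bubble_measure M (F_ab M F X a b) (S_ab X a b)"
proof -
  define good where "good s j t p \<longleftrightarrow> s + 1 \<le> t \<and> 0 < p \<and>
      (\<integral>\<^sup>+\<omega>\<in>{\<omega>\<in>space M. \<forall>i<p. X (grid s t p i) \<omega> \<le> X (grid s t p (Suc i)) \<omega>}. ennreal (X t \<omega>) \<partial>M) \<le>
        ennreal (1 / real (Suc j))" for s t and j p :: nat
  \<comment> \<open>The guard \<open>0 \<le> s\<close> stays inside the existential so that choice
    functions on all reals exist; \<open>m_nonneg\<close> discharges it along the recursion.\<close>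
  have "\<forall>s j. \<exists>t p. 0 \<le> s \<longrightarrow> good s j t p"
    unfolding good_def using grid_without_drop_small[of _ "1 / real (Suc _)"] by simp
  then obtain next_time pieces where
    step: "\<And>s j. 0 \<le> s \<Longrightarrow> good s j (next_time s j) (pieces s j)"
    by metis
  define m where "m = rec_nat (1 :: real) (\<lambda>j s. next_time s j)"
  have m: "m 0 = 1" "m (Suc j) = next_time (m j) j" for j
    by (simp_all add: m_def)
  have m_nonneg: "0 \<le> m j" for j
  proof (induction j)
    case (Suc j)
    then show ?case using step[OF Suc, of j] by (simp add: m good_def)
  qed (simp add: m)
  define high where "high j c \<longleftrightarrow>
      (\<integral>\<^sup>+\<omega>\<in>{\<omega>\<in>space M. \<exists>s\<in>{0..m (Suc j)}. c \<le> X s \<omega>}. ennreal (X (m (Suc j)) \<omega>) \<partial>M) \<le>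
        ennreal (1 / real (Suc j))" for j c
  have "\<forall>j. \<exists>c0. \<forall>c\<ge>c0. high j c"
    unfolding high_def by (intro allI hit_expectation_small m_nonneg) simp
  then obtain c where c: "\<And>j c'. c j \<le> c' \<Longrightarrow> high j c'"
    by metis
  \<comment> \<open>The sum dominates the threshold \<open>c j\<close> and makes the levels
    monotone; the term \<open>Suc j\<close> makes them positive and divergent.\<close>
  define \<beta> where "\<beta> j = real (Suc j) + (\<Sum>i\<le>j. \<bar>c i\<bar>)" for j
  have \<beta>_ge: "c j \<le> \<beta> j" for j
  proof -
    have "\<bar>c j\<bar> \<le> (\<Sum>i\<le>j. \<bar>c i\<bar>)" by (intro member_le_sum) auto
    then show ?thesis by (simp add: \<beta>_def)
  qed
  have "mono \<beta>"
    unfolding mono_iff_le_Suc by (simp add: \<beta>_def)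
  interpret block_sampled_martingale M F X m "\<lambda>j. pieces (m j) j" \<beta>
  proof
    show "1 \<le> m 0" by (simp add: m)
    show "m j + 1 \<le> m (Suc j)" "0 < pieces (m j) j" for j
      using step[OF m_nonneg, of j j] by (simp_all add: m good_def)
    show "real (Suc j) \<le> \<beta> j" for j by (simp add: \<beta>_def sum_nonneg)
    show "mono \<beta>" by fact
    show "(\<integral>\<^sup>+\<omega>\<in>{\<omega>\<in>space M. \<forall>i<pieces (m j) j. X (grid (m j) (m (Suc j)) (pieces (m j) j) i) \<omega> \<le>
        X (grid (m j) (m (Suc j)) (pieces (m j) j) (Suc i)) \<omega>}. ennreal (X (m (Suc j)) \<omega>) \<partial>M) \<le> ennreal (1 / real (Suc j))" for j
      using step[OF m_nonneg, of j j] unfolding m good_def by blast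
    show "(\<integral>\<^sup>+\<omega>\<in>{\<omega>\<in>space M. \<exists>s\<in>{0..m (Suc j)}. \<beta> j \<le> X s \<omega>}. ennreal (X (m (Suc j)) \<omega>) \<partial>M) \<le>
        ennreal (1 / real (Suc j))" for j
      by (rule c[OF \<beta>_ge, unfolded high_def])
  qed
  show ?thesis
    using increasing_a increasing_b not_bubble_measure by blast
qed

theorem theorem4p4:
  fixes M :: "'a measure" and F :: "real \<Rightarrow> 'a measure" and X :: "real \<Rightarrow> 'a \<Rightarrow> real"
  assumes "filtered_prob_space M F"
    and "local_martingale M F X"
    and "\<And>\<omega>. \<omega> \<in> space M \<Longrightarrow> continuous_on {0..} (\<lambda>t. X t \<omega>)"
    and "\<And>t \<omega>. 0 \<le> t \<Longrightarrow> \<omega> \<in> space M \<Longrightarrow> 0 < X t \<omega>"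
    and "AE \<omega> in M. ((\<lambda>t. X t \<omega>) \<longlongrightarrow> 0) at_top"
  shows "strict_local_martingale M F X \<longleftrightarrow>
    (\<forall>a b. increasing_to_infinity a \<longrightarrow> increasing_to_infinity b \<longrightarrow>
       bubble_measure M (F_ab M F X a b) (S_ab X a b))"
proof -
  interpret positive_continuous_local_martingale M F X
    using assms by (intro positive_continuous_local_martingale.intro positive_continuous_local_martingale_axioms.intro)
  show ?thesis
  proof
    assume strict: "strict_local_martingale M F X"
    show "\<forall>a b. increasing_to_infinity a \<longrightarrow> increasing_to_infinity b \<longrightarrow>
       bubble_measure M (F_ab M F X a b) (S_ab X a b)"
    proof (intro allI impI)
      fix a b assume "increasing_to_infinity a" "increasing_to_infinity b"
      then interpret sampled_positive_continuous_local_martingale M F X a b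
        by unfold_locales
      show "bubble_measure M (F_ab M F X a b) (S_ab X a b)"
        using bubble_measure_if_not_martingale[OF assms(5)] strict
        by (simp add: strict_local_martingale_def)
    qed
  next
    assume bubble: "\<forall>a b. increasing_to_infinity a \<longrightarrow> increasing_to_infinity b \<longrightarrow>
       bubble_measure M (F_ab M F X a b) (S_ab X a b)"
    \<comment> \<open>Bubbles are assumed for all samplings, so the single sampling without one
      contradicts them.\<close>
    have "\<not> martingale M F {0..} X"
    proof
      assume "martingale M F {0..} X"
      then interpret positive_continuous_martingale M F X
        using assms(5) by unfold_locales
      show False using exists_sampling_without_bubble bubble by blast
    qed
    then show "strict_local_martingale M F X"
      using assms(2) by (simp add: strict_local_martingale_def)
  qed
qed

end
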